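(* Let $k$ be an algebraically closed field, $K=k((t))$, and let $Y\subset\mathrm{GL}_n$ be a closed subvariety (over $k$), where $\mathrm{GL}_n$ is viewed as a spherical homogeneous space of $\mathrm{GL}_n\times\mathrm{GL}_n$ acting by left and right multiplication. Then the spherical tropicalization $\operatorname{Trop}Y\subset\mathbb{Q}^n$ is the conical subset generated by the $n$-tuples $(\alpha_1,\ldots,\alpha_n)$ of invariant factors of matrices $x\in Y(K)$; that is, $\operatorname{Trop}Y$ is the set of all $c\cdot(\alpha_1,\dots,\alpha_n)$ with $c\in\mathbb{Q}_{\ge0}$ and $(\alpha_1,\dots,\alpha_n)$ the invariant factors of some $x\in Y(K)$.
   Context: Invariant factors: for an invertible $n\times n$ matrix $x$ over $K$ there are $g,h\in\mathrm{GL}_n(k[[t]])$ with $gxh=\operatorname{diag}(t^{\alpha_1},\dots,t^{\alpha_n})$ for unique integers $\alpha_1\ge\cdots\ge\alpha_n$, called the invariant factors of $x$. Spherical structure: $G\times G$ with $G=\mathrm{GL}_n$ acts on $G$ by $(g,h)\cdot x=gxh^{-1}$; the Borel subgroup $B$ consists of pairs (upper triangular, lower triangular). Let $f'_i$ be the determinant of the submatrix $(x_{ab})_{i\le a,b\le n}$, let $f_i=f'_i/f'_{i+1}$ for $i<n$ and $f_n=f'_n$. The $B$-weights $\chi_i$ of $f_1,\dots,f_n$ form a basis of the lattice $\Lambda$ of weights of $B$-semi-invariant rational functions on $\mathrm{GL}_n$, and $\mathrm{Q}=\operatorname{Hom}(\Lambda,\mathbb{Q})$ is identified with $\mathbb{Q}^n$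 via the dual basis. Tropicalization: let $\overline{K}=\bigcup_{m}k((t^{1/m}))$ and let $\nu$ be the valuation giving the smallest exponent with nonzero coefficient. For $\gamma\in\mathrm{GL}_n(\overline{K})$ and $f\in k(\mathrm{GL}_n)^\times$ put $v_\gamma(f)=\nu(\gamma^*(gf))$ for sufficiently general $g\in G\times G$ (equivalently the minimum over $g$). Identify $v_\gamma$ with $(v_\gamma(f_1),\dots,v_\gamma(f_n))\in\mathbb{Q}^n$. Then $\operatorname{Trop}Y=\{v_\gamma:\gamma\in Y(\overline{K})\}$. *)

theory Defs
  imports
    "HOL-Computational_Algebra.Computational_Algebra"
    "HOL-Library.Poly_Mapping"
    "HOL-Library.Product_Lexorder"
    "Jordan_Normal_Form.Matrix"
    "Jordan_Normal_Form.Determinant"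
    "Jordan_Normal_Form.Gauss_Jordan_Elimination"
    "Jordan_Normal_Form.DL_Submatrix"
begin

section \<open>The field of series in fractional powers of \<open>t\<close>\<close>

text \<open>
  The pair \<open>(m, f)\<close> stands for \<open>f(t\<^sup>1\<^sup>/\<^sup>m) \<in> k((t\<^sup>1\<^sup>/\<^sup>m))\<close>, so the quotient is the union
  of the fields \<open>k((t\<^sup>1\<^sup>/\<^sup>m))\<close>. In positive characteristic it is not algebraically closed.
\<close>

definition puiseux_rel :: "nat \<times> 'a::zero fls \<Rightarrow> nat \<times> 'a fls \<Rightarrow> bool" where
  "puiseux_rel = (\<lambda>(m, f) (m', f'). m > 0 \<and> m' > 0 \<and>
     fls_compose_power f m' = fls_compose_power f' m)"

lemma fls_compose_power_compose_power:
  assumes "d > 0" "e > 0"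
  shows "fls_compose_power (fls_compose_power f d) e = fls_compose_power f (d * e)"
proof (rule fls_eqI)
  fix n :: int
  have "int d dvd n div int e \<longleftrightarrow> int d * int e dvd n" if "int e dvd n"
    using that assms by (auto elim!: dvdE simp: mult.commute)
  moreover have "int e dvd n" if "int d * int e dvd n"
    using that by (metis dvd_mult_right)
  moreover have "n div int e div int d = n div (int d * int e)"
    by (simp add: zdiv_zmult2_eq[symmetric] mult.commute)
  ultimately show "fls_nth (fls_compose_power (fls_compose_power f d) e) n = fls_nth (fls_compose_power f (d * e)) n"
    using assms by (auto simp: fls_nth_compose_power)
qed

lemma fls_compose_power_inject:
  assumes "d > 0"
  shows "fls_compose_power f d = fls_compose_power g d \<longleftrightarrow> f = g"
proof
  assume eq: "fls_compose_power f d = fls_compose_power g d"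
  show "f = g"
  proof (rule fls_eqI)
    fix n
    have "fls_nth (fls_compose_power f d) (int d * n) = fls_nth (fls_compose_power g d) (int d * n)"
      using eq by simp
    thus "fls_nth f n = fls_nth g n"
      using assms by (simp add: fls_nth_compose_power)
  qed
qed simp

lemma fls_compose_power_eq_0_iff:
  "d > 0 \<Longrightarrow> fls_compose_power f d = 0 \<longleftrightarrow> f = 0"
  using fls_compose_power_inject[of d f 0] by simp

lemma fls_compose_power_inverse:
  fixes f :: "'a::field fls"
  assumes "d > 0"
  shows "fls_compose_power (inverse f) d = inverse (fls_compose_power f d)"
proof (cases "f = 0")
  case False
  have "fls_compose_power f d * fls_compose_power (inverse f) d = fls_compose_power (f * inverse f) d"
    by simp
  also have "\<dots> = 1"
    using False assms by simp
  finally show ?thesis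
    by (metis inverse_unique)
qed simp

lemma fls_subdegree_compose_power:
  assumes "d > 0"
  shows "fls_subdegree (fls_compose_power f d) = int d * fls_subdegree f"
proof (cases "f = 0")
  case False
  show ?thesis
  proof (rule fls_subdegree_eqI)
    show "fls_nth (fls_compose_power f d) (int d * fls_subdegree f) \<noteq> 0"
      using assms False by (simp add: fls_nth_compose_power)
  next
    fix k assume k: "k < int d * fls_subdegree f"
    show "fls_nth (fls_compose_power f d) k = 0"
      using assms k by (auto simp: fls_nth_compose_power)
  qed
qed simp

lemma part_equivp_puiseux_rel:
  "part_equivp (puiseux_rel :: nat \<times> 'a::zero fls \<Rightarrow> nat \<times> 'a fls \<Rightarrow> bool)" (is "part_equivp ?R")
proof (rule part_equivpI)
  show "\<exists>x :: nat \<times> 'a fls. puiseux_rel x x"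
    by (rule exI[of _ "(1, 0)"]) (simp add: puiseux_rel_def)
  show "symp ?R"
    by (auto simp: symp_def puiseux_rel_def)
  show "transp ?R"
  proof (rule transpI)
    fix x y z :: "nat \<times> 'a fls"
    assume rel: "puiseux_rel x y" "puiseux_rel y z"
    obtain m f m' f' m'' f'' where xyz: "x = (m, f)" "y = (m', f')" "z = (m'', f'')"
      by (metis surj_pair)
    from rel[unfolded xyz]
    have pos: "m > 0" "m' > 0" "m'' > 0"
      and eq: "fls_compose_power f m' = fls_compose_power f' m"
              "fls_compose_power f' m'' = fls_compose_power f'' m'"
      by (auto simp: puiseux_rel_def)
    have "fls_compose_power (fls_compose_power f m'') m' = fls_compose_power (fls_compose_power f m') m''"
      using pos by (simp add: fls_compose_power_compose_power mult.commute)
    also have "\<dots> = fls_compose_power (fls_compose_power f' m'') m"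
      using pos by (simp add: fls_compose_power_compose_power mult.commute eq(1))
    also have "\<dots> = fls_compose_power (fls_compose_power f'' m) m'"
      unfolding eq(2) using pos by (simp add: fls_compose_power_compose_power mult.commute)
    finally show "puiseux_rel x z"
      using pos by (simp add: xyz puiseux_rel_def fls_compose_power_inject)
  qed
qed

quotient_type (overloaded) 'a puiseux = "nat \<times> 'a::zero fls" / partial: puiseux_rel
  by (rule part_equivp_puiseux_rel)

lemma fls_compose_power_swap:
  assumes "fls_compose_power f m' = fls_compose_power f' m" "m > 0" "m' > 0" "d > 0"
  shows "fls_compose_power f (m' * d) = fls_compose_power f' (m * d)"
  using assms by (metis fls_compose_power_compose_power)

instantiation puiseux :: (field) field
begin

lift_definition zero_puiseux :: "'a puiseux" is "(1, 0)"
  by (simp add: puiseux_rel_def)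

lift_definition one_puiseux :: "'a puiseux" is "(1, 1)"
  by (simp add: puiseux_rel_def)

lift_definition plus_puiseux :: "'a puiseux \<Rightarrow> 'a puiseux \<Rightarrow> 'a puiseux" is
  "\<lambda>(m, f) (l, g). (m * l, fls_compose_power f l + fls_compose_power g m)"
  apply (clarsimp simp: puiseux_rel_def fls_compose_power_compose_power)
  subgoal for m f m' f' l g l' g'
    using fls_compose_power_swap[of f m' f' m "l * l'"] fls_compose_power_swap[of g l' g' l "m * m'"]
    by (simp add: ac_simps)
  done

lift_definition times_puiseux :: "'a puiseux \<Rightarrow> 'a puiseux \<Rightarrow> 'a puiseux" is
  "\<lambda>(m, f) (l, g). (m * l, fls_compose_power f l * fls_compose_power g m)"
  apply (clarsimp simp: puiseux_rel_def fls_compose_power_compose_power)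
  subgoal for m f m' f' l g l' g'
    using fls_compose_power_swap[of f m' f' m "l * l'"] fls_compose_power_swap[of g l' g' l "m * m'"]
    by (simp add: ac_simps)
  done

lift_definition uminus_puiseux :: "'a puiseux \<Rightarrow> 'a puiseux" is "\<lambda>(m, f). (m, - f)"
  by (auto simp: puiseux_rel_def)

lift_definition inverse_puiseux :: "'a puiseux \<Rightarrow> 'a puiseux" is "\<lambda>(m, f). (m, inverse f)"
  by (auto simp: puiseux_rel_def fls_compose_power_inverse)

definition minus_puiseux :: "'a puiseux \<Rightarrow> 'a puiseux \<Rightarrow> 'a puiseux" where
  "x - y = x + - (y :: 'a puiseux)"

definition divide_puiseux :: "'a puiseux \<Rightarrow> 'a puiseux \<Rightarrow> 'a puiseux" where
  "x div y = x * inverse (y :: 'a puiseux)"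

instance
proof
  fix a b c :: "'a puiseux"
  show "a + b + c = a + (b + c)"
    by transfer (auto simp: puiseux_rel_def fls_compose_power_compose_power ac_simps)
  show "a + b = b + a"
    by transfer (auto simp: puiseux_rel_def fls_compose_power_compose_power ac_simps)
  show "0 + a = a"
    by transfer (auto simp: puiseux_rel_def fls_compose_power_compose_power ac_simps)
  show "- a + a = 0"
    by transfer (auto simp: puiseux_rel_def fls_compose_power_compose_power ac_simps)
  show "a - b = a + - b"
    by (simp add: minus_puiseux_def)
  show "a * b * c = a * (b * c)"
    by transfer (auto simp: puiseux_rel_def fls_compose_power_compose_power ac_simps)
  show "a * b = b * a"
    by transfer (auto simp: puiseux_rel_def fls_compose_power_compose_power ac_simps)
  show "1 * a = a"
    by transfer (auto simp: puiseux_rel_def fls_compose_power_compose_power ac_simps)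
  show "(a + b) * c = a * c + b * c"
    by transfer (auto simp: puiseux_rel_def fls_compose_power_compose_power algebra_simps)
  show "(0 :: 'a puiseux) \<noteq> 1"
    by transfer (auto simp: puiseux_rel_def)
  show "a \<noteq> 0 \<Longrightarrow> inverse a * a = 1"
    by transfer
      (auto simp: puiseux_rel_def fls_compose_power_compose_power fls_compose_power_inverse
                  fls_compose_power_eq_0_iff)
  show "a div b = a * inverse b"
    by (simp add: divide_puiseux_def)
  show "inverse (0 :: 'a puiseux) = 0"
    by transfer (auto simp: puiseux_rel_def)
qed

end

lift_definition puiseux_const :: "'a::zero \<Rightarrow> 'a puiseux" is "\<lambda>c. (1, fls_const c)"
  by (simp add: puiseux_rel_def)

text \<open>The valuation \<open>\<nu>\<close>; its value at \<open>0\<close> is a dummy.\<close>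

lift_definition puiseux_val :: "'a::zero puiseux \<Rightarrow> rat" is
  "\<lambda>(m, f). of_int (fls_subdegree f) / of_nat m"
proof clarify
  fix m m' :: nat and f f' :: "'a fls"
  assume rel: "puiseux_rel (m, f) (m', f')"
  hence "int m' * fls_subdegree f = int m * fls_subdegree f'"
    unfolding puiseux_rel_def by (metis (mono_tags) case_prod_conv fls_subdegree_compose_power)
  hence "of_nat m' * (of_int (fls_subdegree f) :: rat) = of_nat m * of_int (fls_subdegree f')"
    by (metis of_int_mult of_int_of_nat_eq)
  thus "(of_int (fls_subdegree f) :: rat) / of_nat m = of_int (fls_subdegree f') / of_nat m'"
    using rel by (simp add: puiseux_rel_def field_simps)
qed


section \<open>Polynomials and Zariski-closed sets\<close>

type_synonym ('v, 'a) mpoly = "('v \<Rightarrow>\<^sub>0 nat) \<Rightarrow>\<^sub>0 'a"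

definition mpolys :: "'v set \<Rightarrow> ('v, 'a::zero) mpoly set" where
  "mpolys V = {p. \<forall>m\<in>Poly_Mapping.keys p. Poly_Mapping.keys m \<subseteq> V}"

definition mpoly_var :: "'v \<Rightarrow> ('v, 'a::zero_neq_one) mpoly" where
  "mpoly_var v = Poly_Mapping.single (Poly_Mapping.single v 1) 1"

text \<open>Evaluation in a \<open>k\<close>-algebra \<open>R\<close> with structure map \<open>\<phi> : k \<rightarrow> R\<close>.\<close>

definition mpoly_eval ::
    "('a::zero \<Rightarrow> 'r::comm_ring_1) \<Rightarrow> ('v \<Rightarrow> 'r) \<Rightarrow> ('v, 'a) mpoly \<Rightarrow> 'r" where
  "mpoly_eval \<phi> a p = (\<Sum>m\<in>Poly_Mapping.keys p.
     \<phi> (Poly_Mapping.lookup p m) * (\<Prod>v\<in>Poly_Mapping.keys m. a v ^ Poly_Mapping.lookup m v))"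

definition GL :: "nat \<Rightarrow> 'a::semiring_1 mat set" where
  "GL n = {A \<in> carrier_mat n n. invertible_mat A}"

abbreviation mat_vars :: "nat \<Rightarrow> (nat \<times> nat) set" where
  "mat_vars n \<equiv> {..<n} \<times> {..<n}"

text \<open>
  Closed subsets of \<open>GL\<^sub>n\<close> (in the subspace topology of the affine space of matrices;
  inverting the determinant yields no further closed sets) and of \<open>GL\<^sub>n \<times> GL\<^sub>n\<close>.
\<close>

definition zclosed_GL :: "nat \<Rightarrow> 'a::field mat set \<Rightarrow> bool" where
  "zclosed_GL n Y \<longleftrightarrow>
     (\<exists>S\<subseteq>mpolys (mat_vars n). Y = {x \<in> GL n. \<forall>p\<in>S. mpoly_eval (\<lambda>c. c) (($$) x) p = 0})"

definition zclosed_GL2 :: "nat \<Rightarrow> ('a::field mat \<times> 'a mat) set \<Rightarrow> bool" where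
  "zclosed_GL2 n Z \<longleftrightarrow>
     (\<exists>S\<subseteq>mpolys (mat_vars n <+> mat_vars n).
        Z = {(g, h) \<in> GL n \<times> GL n. \<forall>p\<in>S. mpoly_eval (\<lambda>c. c) (case_sum (($$) g) (($$) h)) p = 0})"

definition zopen_GL2 :: "nat \<Rightarrow> ('a::field mat \<times> 'a mat) set \<Rightarrow> bool" where
  "zopen_GL2 n U \<longleftrightarrow> U \<subseteq> GL n \<times> GL n \<and> zclosed_GL2 n (GL n \<times> GL n - U)"

text \<open>
  A closed subvariety is given by its set \<open>Y\<close> of \<open>k\<close>-points, \<open>k\<close> being algebraically
  closed; its points over a \<open>k\<close>-algebra \<open>R\<close> are the matrices in \<open>GL\<^sub>n(R)\<close> at which
  the vanishing ideal of \<open>Y\<close> vanishes.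
\<close>

definition vanishing_ideal :: "nat \<Rightarrow> 'a::field mat set \<Rightarrow> (nat \<times> nat, 'a) mpoly set" where
  "vanishing_ideal n Y =
     {p \<in> mpolys (mat_vars n). \<forall>y\<in>Y. mpoly_eval (\<lambda>c. c) (($$) y) p = 0}"

definition points_over ::
    "('a::field \<Rightarrow> 'r::comm_ring_1) \<Rightarrow> nat \<Rightarrow> 'a mat set \<Rightarrow> 'r mat set" where
  "points_over \<phi> n Y = {x \<in> GL n. \<forall>p\<in>vanishing_ideal n Y. mpoly_eval \<phi> (($$) x) p = 0}"


section \<open>Invariant factors\<close>

definition is_invariant_factors :: "nat \<Rightarrow> 'a::field fls mat \<Rightarrow> int vec \<Rightarrow> bool" where
  "is_invariant_factors n x \<alpha> \<longleftrightarrow>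
     \<alpha> \<in> carrier_vec n \<and> (\<forall>i j. i \<le> j \<longrightarrow> j < n \<longrightarrow> \<alpha> $ j \<le> \<alpha> $ i) \<and>
     (\<exists>g\<in>GL n. \<exists>h\<in>GL n.
        map_mat fps_to_fls g * x * map_mat fps_to_fls h = mat_diag n (\<lambda>i. fls_X_intpow (\<alpha> $ i)))"


section \<open>Spherical tropicalization\<close>

text \<open>
  The function field \<open>k(GL\<^sub>n)\<close> consists of the fractions of polynomials in the \<open>n\<^sup>2\<close>
  matrix entries. The relation \<open>ratfun_value \<phi> n f x y\<close> says that \<open>f\<close> is defined at the
  \<open>R\<close>-point \<open>x\<close> and takes the value \<open>y\<close> there.
\<close>

definition ratfun_value ::
    "('a::field \<Rightarrow> 'r::field) \<Rightarrow> nat \<Rightarrow> (nat \<times> nat, 'a) mpoly fract \<Rightarrow> 'r mat \<Rightarrow> 'r \<Rightarrow> bool" where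
  "ratfun_value \<phi> n f x y \<longleftrightarrow>
     (\<exists>p\<in>mpolys (mat_vars n). \<exists>q\<in>mpolys (mat_vars n).
        f = Fract p q \<and> mpoly_eval \<phi> (($$) x) q \<noteq> 0 \<and>
        y = mpoly_eval \<phi> (($$) x) p / mpoly_eval \<phi> (($$) x) q)"

text \<open>
  \<open>v\<^sub>\<gamma>(f) = \<nu>(\<gamma>\<^sup>*((g,h)f))\<close> for general \<open>(g,h)\<close>, where
  \<open>((g,h)f)(x) = f((g,h)\<^sup>-\<^sup>1 \<cdot> x) = f(g\<^sup>-\<^sup>1 x h)\<close>.
\<close>

definition trop_val ::
    "nat \<Rightarrow> 'a::field puiseux mat \<Rightarrow> (nat \<times> nat, 'a) mpoly fract \<Rightarrow> rat" where
  "trop_val n \<gamma> f = (THE a. \<exists>U. zopen_GL2 n U \<and> U \<noteq> {} \<and> (\<forall>(g, h)\<in>U. \<exists>y.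
     ratfun_value puiseux_const n f
       (map_mat puiseux_const (the (mat_inverse g)) * \<gamma> * map_mat puiseux_const h) y \<and>
     y \<noteq> 0 \<and> puiseux_val y = a))"

text \<open>
  Rows and columns are numbered from \<open>0\<close>. Thus \<open>corner_minor n n = 1\<close> is the determinant of
  the empty matrix, and \<open>spherical_fun n (n - 1) = corner_minor n (n - 1)\<close> (as a fraction).
\<close>

definition corner_minor :: "nat \<Rightarrow> nat \<Rightarrow> (nat \<times> nat, 'a::field) mpoly" where
  "corner_minor n i = det (submatrix (mat n n mpoly_var) {i..<n} {i..<n})"

definition spherical_fun :: "nat \<Rightarrow> nat \<Rightarrow> (nat \<times> nat, 'a::field) mpoly fract" where
  "spherical_fun n i = Fract (corner_minor n i) (corner_minor n (Suc i))"

definition spherical_trop :: "nat \<Rightarrow> 'a::field mat set \<Rightarrow> rat vec set" where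
  "spherical_trop n Y =
     {vec n (\<lambda>i. trop_val n \<gamma> (spherical_fun n i)) | \<gamma>. \<gamma> \<in> points_over puiseux_const n Y}"

end

theory Submission
  imports Defs
begin

text \<open>
  Write \<open>x = g\<^sub>1 D h\<^sub>1\<close> with \<open>D = diag(t\<^sup>\<alpha>)\<close> and \<open>g\<^sub>1, h\<^sub>1\<close> invertible over \<open>k[[t]]\<close>. Expanding the rows of a
  product shows that \<open>f'\<^sub>i(g\<^sup>-\<^sup>1 x h)\<close> is a sum of terms, integral over \<open>k[[t]]\<close>, times \<open>t\<close> to the sum of
  \<open>n - i\<close> distinct invariant factors. The smallest such sum is the tail sum \<open>s\<^sub>i\<close> of the decreasing
  sequence \<open>\<alpha>\<close>. The coefficient of \<open>t\<close> to the power \<open>s\<^sub>i\<close> is, up to a power of \<open>det g\<close>, a polynomial in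
  \<open>(g, h)\<close>, and at \<open>(g\<^sub>1(0), h\<^sub>1(0)\<^sup>-\<^sup>1)\<close> it does not vanish. So for general \<open>(g, h)\<close> the valuation of \<open>f'\<^sub>i\<close>
  is exactly \<open>s\<^sub>i\<close>, and that of \<open>f\<^sub>i = f'\<^sub>i / f'\<^sub>i\<^sub>+\<^sub>1\<close> is \<open>\<alpha>\<^sub>i\<close>. The substitution \<open>t \<mapsto> t\<^sup>c\<close> multiplies all
  valuations by \<open>c\<close>, preserves the points of \<open>Y\<close>, and every Puiseux point of \<open>Y\<close> arises from one over \<open>k((t))\<close>
  with \<open>c = 1/m\<close>; for \<open>c = 0\<close> one uses a constant point of \<open>Y\<close>.
\<close>

section \<open>Evaluation of polynomials\<close>

definition monomial_eval :: "('v \<Rightarrow> 'r::comm_ring_1) \<Rightarrow> ('v \<Rightarrow>\<^sub>0 nat) \<Rightarrow> 'r" where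
  "monomial_eval a m = (\<Prod>v\<in>Poly_Mapping.keys m. a v ^ Poly_Mapping.lookup m v)"

text \<open>Absent variables have exponent 0 and contribute the factor 1, so monomials with
  different supports can be multiplied over one common index set.\<close>

lemma monomial_eval_superset:
  assumes "finite S" "Poly_Mapping.keys m \<subseteq> S"
  shows "monomial_eval a m = (\<Prod>v\<in>S. a v ^ Poly_Mapping.lookup m v)"
  unfolding monomial_eval_def
  by (rule prod.mono_neutral_left) (use assms in \<open>auto simp: in_keys_iff\<close>)

lemma monomial_eval_0 [simp]: "monomial_eval a 0 = 1"
  by (simp add: monomial_eval_def)

lemma monomial_eval_add: "monomial_eval a (m + m') = monomial_eval a m * monomial_eval a m'"
proof -
  let ?S = "Poly_Mapping.keys m \<union> Poly_Mapping.keys m'"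
  have "Poly_Mapping.keys (m + m') \<subseteq> ?S"
    by (rule Poly_Mapping.keys_add)
  thus ?thesis
    by (simp add: monomial_eval_superset[of ?S] lookup_add power_add prod.distrib)
qed

lemma monomial_eval_cong:
  "(\<And>v. v \<in> Poly_Mapping.keys m \<Longrightarrow> a v = b v) \<Longrightarrow> monomial_eval a m = monomial_eval b m"
  by (simp add: monomial_eval_def)

lemma (in comm_ring_hom) hom_monomial_eval:
  "hom (monomial_eval a m) = monomial_eval (\<lambda>v. hom (a v)) m"
  by (simp add: monomial_eval_def hom_distribs)

lemma mpoly_eval_alt:
  "mpoly_eval \<phi> a p =
     (\<Sum>m\<in>Poly_Mapping.keys p. \<phi> (Poly_Mapping.lookup p m) * monomial_eval a m)"
  by (simp add: mpoly_eval_def monomial_eval_def)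

context comm_ring_hom
begin

lemma mpoly_eval_superset:
  assumes "finite S" "Poly_Mapping.keys p \<subseteq> S"
  shows "mpoly_eval hom a p = (\<Sum>m\<in>S. hom (Poly_Mapping.lookup p m) * monomial_eval a m)"
  unfolding mpoly_eval_alt
  by (rule sum.mono_neutral_left) (use assms in \<open>auto simp: in_keys_iff\<close>)

lemma mpoly_eval_add: "mpoly_eval hom a (p + q) = mpoly_eval hom a p + mpoly_eval hom a q"
proof -
  let ?S = "Poly_Mapping.keys p \<union> Poly_Mapping.keys q"
  have "Poly_Mapping.keys (p + q) \<subseteq> ?S"
    by (rule Poly_Mapping.keys_add)
  thus ?thesis
    by (simp add: mpoly_eval_superset[of ?S] lookup_add hom_add ring_distribs sum.distrib)
qed

lemma mpoly_eval_single:
  "mpoly_eval hom a (Poly_Mapping.single m c) = hom c * monomial_eval a m"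
  by (subst mpoly_eval_superset[of "{m}"]) auto

lemma mpoly_eval_mult: "mpoly_eval hom a (p * q) = mpoly_eval hom a p * mpoly_eval hom a q"
proof -
  \<comment> \<open>Writing an \<open>update\<close> at a fresh exponent as the addition of a single
    term lets additivity drive two inductions: over \<open>q\<close> with a single term on the left,
    then over \<open>p\<close>.\<close>
  have upd: "Poly_Mapping.update m c f = f + Poly_Mapping.single m c"
    if "m \<notin> Poly_Mapping.keys f" for m and c :: 'a and f :: "('v, 'a) mpoly"
    using that
    by (intro poly_mapping_eqI) (auto simp: lookup_update lookup_add lookup_single in_keys_iff when_def)
  have single: "mpoly_eval hom a (Poly_Mapping.single m c * q) =
      mpoly_eval hom a (Poly_Mapping.single m c) * mpoly_eval hom a q" for m c q
  proof (induction q rule: Poly_Mapping.update_induct)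
    case const
    show ?case by (simp add: mpoly_eval_alt)
  next
    case (update f m' c')
    thus ?case
      by (simp add: upd
          ring_distribs mpoly_eval_add mult_single mpoly_eval_single monomial_eval_add hom_mult mult_ac)
  qed
  show ?thesis
  proof (induction p rule: Poly_Mapping.update_induct)
    case const
    show ?case by (simp add: mpoly_eval_alt)
  next
    case (update f m c)
    thus ?case
      by (simp add: upd
          ring_distribs mpoly_eval_add single)
  qed
qed

lemma mpoly_eval_const: "mpoly_eval hom a (Poly_Mapping.single 0 c) = hom c"
  by (simp add: mpoly_eval_single)

lemma mpoly_eval_var: "mpoly_eval hom a (mpoly_var v) = a v"
  by (simp add: mpoly_eval_single mpoly_var_def monomial_eval_def)

lemma mpoly_eval_hom: "comm_ring_hom (mpoly_eval hom a)"
proof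
  show "mpoly_eval hom a 0 = 0"
    by (simp add: mpoly_eval_alt)
  show "mpoly_eval hom a 1 = 1"
    using mpoly_eval_const[of a 1] by simp
qed (fact mpoly_eval_add mpoly_eval_mult)+

end

lemma mpoly_eval_cong:
  assumes "p \<in> mpolys V" "\<And>v. v \<in> V \<Longrightarrow> a v = b v"
  shows "mpoly_eval \<phi> a p = mpoly_eval \<phi> b p"
  unfolding mpoly_eval_alt
  by (intro sum.cong refl arg_cong2[where f = "(*)"] monomial_eval_cong)
     (use assms in \<open>auto simp: mpolys_def\<close>)

lemma (in comm_ring_hom) hom_mpoly_eval:
  "hom (mpoly_eval \<phi> a p) = mpoly_eval (\<lambda>c. hom (\<phi> c)) (\<lambda>v. hom (a v)) p"
  by (simp add: mpoly_eval_alt hom_distribs hom_monomial_eval)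

lemma mpolys_add: "p \<in> mpolys V \<Longrightarrow> q \<in> mpolys V \<Longrightarrow> p + q \<in> mpolys V"
  using Poly_Mapping.keys_add[of p q] by (auto simp: mpolys_def)

lemma mpolys_uminus: "(p :: ('v, 'a::ab_group_add) mpoly) \<in> mpolys V \<Longrightarrow> - p \<in> mpolys V"
  by (auto simp: mpolys_def in_keys_iff)

lemma mpolys_mult: "(p :: ('v, 'a::comm_ring_1) mpoly) \<in> mpolys V \<Longrightarrow> q \<in> mpolys V \<Longrightarrow> p * q \<in> mpolys V"
proof -
  assume pq: "p \<in> mpolys V" "q \<in> mpolys V"
  show "p * q \<in> mpolys V"
    unfolding mpolys_def
  proof clarify
    fix m v assume "m \<in> Poly_Mapping.keys (p * q)" "v \<in> Poly_Mapping.keys m"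
    then obtain a b where ab: "m = a + b" "a \<in> Poly_Mapping.keys p" "b \<in> Poly_Mapping.keys q"
      using keys_mult[of p q] by blast
    with \<open>v \<in> Poly_Mapping.keys m\<close> show "v \<in> V"
      using pq Poly_Mapping.keys_add[of a b] unfolding mpolys_def by blast
  qed
qed

lemma mpolys_const: "Poly_Mapping.single 0 c \<in> mpolys V"
  by (auto simp: mpolys_def)

lemma mpolys_var: "v \<in> V \<Longrightarrow> mpoly_var v \<in> mpolys V"
  by (auto simp: mpolys_def mpoly_var_def)

lemma mpolys_0: "0 \<in> mpolys V"
  by (auto simp: mpolys_def)

lemma mpolys_1: "1 \<in> mpolys V"
  by (simp add: mpolys_const flip: single_one)

lemma mpolys_sum:
  "(\<And>i. i \<in> I \<Longrightarrow> f i \<in> mpolys V) \<Longrightarrow> (sum f I :: ('v, 'a::comm_ring_1) mpoly) \<in> mpolys V"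
  by (induction I rule: infinite_finite_induct) (auto intro: mpolys_add mpolys_0)

lemma mpolys_prod:
  "(\<And>i. i \<in> I \<Longrightarrow> f i \<in> mpolys V) \<Longrightarrow> (prod f I :: ('v, 'a::comm_ring_1) mpoly) \<in> mpolys V"
  by (induction I rule: infinite_finite_induct) (auto intro: mpolys_mult mpolys_1)

lemma mpolys_det:
  assumes "\<And>i j. i < n \<Longrightarrow> j < n \<Longrightarrow> A $$ (i, j) \<in> mpolys V" "A \<in> carrier_mat n n"
  shows "(det A :: ('v, 'a::comm_ring_1) mpoly) \<in> mpolys V"
proof -
  have "signof p \<in> mpolys V" for p :: "nat \<Rightarrow> nat"
    by (auto simp: sign_def mpolys_1 intro: mpolys_uminus)
  thus ?thesis
    unfolding det_def'[OF assms(2)]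
    by (auto intro!: mpolys_sum mpolys_mult mpolys_prod assms(1) simp: permutes_in_image)
qed

section \<open>Restriction of polynomials to lines, and infinitude of the field\<close>

lemma mpoly_eval_line:
  fixes a b :: "'v \<Rightarrow> 'a::field"
  shows "\<exists>P. \<forall>s. poly P s = mpoly_eval (\<lambda>c. c) (\<lambda>v. a v + s * (b v - a v)) p"
proof (intro exI allI)
  fix s :: 'a
  interpret comm_ring_hom "\<lambda>P. poly P s"
    by unfold_locales auto
  \<comment> \<open>The line is parametrized over the univariate polynomial ring: \<open>p\<close>
    is evaluated at the linear polynomials \<open>[:a v, b v - a v:]\<close>, and specialization at
    \<open>s\<close> is a ring homomorphism, hence commutes with this evaluation.\<close>
  show "poly (mpoly_eval (\<lambda>c. [:c:]) (\<lambda>v. [:a v, b v - a v:]) p) s =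
      mpoly_eval (\<lambda>c. c) (\<lambda>v. a v + s * (b v - a v)) p"
    by (simp add: hom_mpoly_eval)
qed

text \<open>Over a finite field the product of all \<open>X - c\<close>, plus 1, would have positive
  degree but no root.\<close>

lemma infinite_UNIV_alg_closed: "infinite (UNIV :: 'a::alg_closed_field set)"
proof
  assume fin: "finite (UNIV :: 'a set)"
  let ?p = "(\<Prod>c\<in>(UNIV::'a set). [:-c, 1:]) :: 'a poly"
  have "degree ?p = card (UNIV :: 'a set)"
    by (subst degree_prod_eq_sum_degree) (auto)
  moreover have "card (UNIV :: 'a set) > 0"
    using fin by (simp add: card_gt_0_iff)
  ultimately have "degree (?p + 1) > 0"
    by (subst degree_add_eq_left) auto
  then obtain x where "poly (?p + 1) x = 0"
    using alg_closed_imp_poly_has_root by blast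
  moreover have "poly ?p x = 0"
    using fin by (auto simp: poly_prod)
  ultimately show False by simp
qed

section \<open>General linear groups\<close>

lemma GL_iff:
  "A \<in> GL n \<longleftrightarrow> A \<in> carrier_mat n n \<and> (\<exists>B\<in>carrier_mat n n. A * B = 1\<^sub>m n \<and> B * A = 1\<^sub>m n)"
proof
  assume A: "A \<in> GL n"
  then obtain B where B: "A * B = 1\<^sub>m n" "B * A = 1\<^sub>m (dim_row B)" "A \<in> carrier_mat n n"
    by (auto simp: GL_def invertible_mat_def inverts_mat_def)
  \<comment> \<open>\<open>invertible_mat\<close> leaves the size of the inverse open; comparing
    column counts in the two products fixes it.\<close>
  have "B \<in> carrier_mat n n"
    using arg_cong[OF B(1), of dim_col] arg_cong[OF B(2), of dim_col] B(3) by auto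
  thus "A \<in> carrier_mat n n \<and> (\<exists>B\<in>carrier_mat n n. A * B = 1\<^sub>m n \<and> B * A = 1\<^sub>m n)"
    using B by auto
qed (auto simp: GL_def invertible_mat_def inverts_mat_def)

lemma GL_carrier: "A \<in> GL n \<Longrightarrow> A \<in> carrier_mat n n"
  by (simp add: GL_iff)

lemma GL_obtain_inverse:
  assumes "A \<in> GL n"
  obtains B where "B \<in> GL n" "A * B = 1\<^sub>m n" "B * A = 1\<^sub>m n"
  using assms by (auto simp: GL_iff)

lemma GL_one: "1\<^sub>m n \<in> GL n"
  by (auto simp: GL_iff intro!: bexI[of _ "1\<^sub>m n"])

lemma GL_mult:
  assumes "A \<in> GL n" "B \<in> GL n"
  shows "A * B \<in> GL n"
proof -
  obtain A' B' where A': "A' \<in> GL n" "A * A' = 1\<^sub>m n" "A' * A = 1\<^sub>m n"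
    and B': "B' \<in> GL n" "B * B' = 1\<^sub>m n" "B' * B = 1\<^sub>m n"
    using assms by (meson GL_obtain_inverse)
  note carrier = GL_carrier[OF assms(1)] GL_carrier[OF assms(2)] GL_carrier[OF A'(1)] GL_carrier[OF B'(1)]
  have "A * B * (B' * A') = A * (B * B') * A'" "B' * A' * (A * B) = B' * (A' * A) * B"
    using carrier by (simp_all add: assoc_mult_mat[of _ n n _ n _ n])
  hence "A * B * (B' * A') = 1\<^sub>m n" "B' * A' * (A * B) = 1\<^sub>m n"
    using A' B' carrier by simp_all
  moreover have "A * B \<in> carrier_mat n n" "B' * A' \<in> carrier_mat n n"
    using carrier by auto
  ultimately show ?thesis
    unfolding GL_iff by blast
qed

lemma GL_det_unit:
  fixes A :: "'a::comm_ring_1 mat"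
  assumes "A \<in> GL n"
  shows "det A dvd 1"
proof -
  obtain B where "B \<in> carrier_mat n n" "A * B = 1\<^sub>m n" "A \<in> carrier_mat n n"
    using assms by (auto simp: GL_iff)
  hence "det A * det B = 1"
    using det_mult[of A n B] by simp
  thus ?thesis
    by (metis dvdI)
qed

text \<open>The adjugate divided by the determinant is an inverse over any commutative ring. The
  case of interest is \<open>k[[t]]\<close>, where a nonzero determinant would not suffice.\<close>

lemma GL_iff_det_unit:
  fixes A :: "'a::comm_ring_1 mat"
  shows "A \<in> GL n \<longleftrightarrow> A \<in> carrier_mat n n \<and> det A dvd 1"
proof (intro iffI conjI)
  assume A: "A \<in> carrier_mat n n \<and> det A dvd 1"
  then obtain c where c: "1 = det A * c"
    by (auto elim: dvdE)
  let ?B = "c \<cdot>\<^sub>m adj_mat A"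
  have "A * ?B = 1\<^sub>m n" "?B * A = 1\<^sub>m n" "?B \<in> carrier_mat n n"
    using adj_mat[of A n] A c
    by (auto simp: mult_smult_distrib mult_smult_assoc_mat mult.commute intro!: eq_matI)
  thus "A \<in> GL n"
    using A by (auto simp: GL_iff)
qed (use GL_det_unit[of A n] in \<open>auto simp: GL_carrier\<close>)

lemma GL_field_iff:
  fixes A :: "'a::field mat"
  shows "A \<in> GL n \<longleftrightarrow> A \<in> carrier_mat n n \<and> det A \<noteq> 0"
  by (auto simp: GL_iff_det_unit dvd_field_iff)

lemma (in comm_ring_hom) hom_GL:
  assumes "A \<in> GL n"
  shows "map_mat hom A \<in> GL n"
proof -
  obtain B where B: "B \<in> carrier_mat n n" "A * B = 1\<^sub>m n" "B * A = 1\<^sub>m n" "A \<in> carrier_mat n n"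
    using assms by (auto simp: GL_iff)
  have "map_mat hom A * map_mat hom B = 1\<^sub>m n" "map_mat hom B * map_mat hom A = 1\<^sub>m n"
    using mat_hom_mult[OF B(4,1)] mat_hom_mult[OF B(1,4)] B(2,3) by (auto simp: mat_hom_one)
  thus ?thesis
    using B by (auto simp: GL_iff intro!: bexI[of _ "map_mat hom B"])
qed

lemma the_mat_inverse:
  fixes A :: "'a::field mat"
  assumes "A \<in> GL n"
  shows "the (mat_inverse A) \<in> GL n" "A * the (mat_inverse A) = 1\<^sub>m n"
    "the (mat_inverse A) * A = 1\<^sub>m n"
proof -
  obtain B where B: "B \<in> carrier_mat n n" "A * B = 1\<^sub>m n" "B * A = 1\<^sub>m n" "A \<in> carrier_mat n n"
    using assms by (auto simp: GL_iff)
  have "A \<in> Units (ring_mat TYPE('a) n ())"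
    using B by (auto simp: Units_def ring_mat_def)
  hence "mat_inverse A \<noteq> None"
    using mat_inverse(1)[OF B(4), where b = "()"] by blast
  then obtain C where "mat_inverse A = Some C"
    by blast
  thus "the (mat_inverse A) \<in> GL n" "A * the (mat_inverse A) = 1\<^sub>m n" "the (mat_inverse A) * A = 1\<^sub>m n"
    using mat_inverse(2)[OF B(4)] B(4) by (auto simp: GL_iff)
qed

text \<open>The entries of the adjugate are polynomial in those of \<open>A\<close>, so open
  conditions on the inverse can be stated through it, up to powers of the determinant.\<close>

lemma mat_inverse_adj_mat:
  fixes A :: "'a::field mat"
  assumes "A \<in> GL n"
  shows "adj_mat A = det A \<cdot>\<^sub>m the (mat_inverse A)"
proof -
  let ?B = "the (mat_inverse A)"
  have A: "A \<in> carrier_mat n n" and B: "?B \<in> carrier_mat n n"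
    using assms the_mat_inverse(1)[OF assms] by (auto simp: GL_carrier)
  have "adj_mat A = adj_mat A * (A * ?B)"
    using adj_mat(1)[OF A] the_mat_inverse(2)[OF assms] by simp
  also have "\<dots> = adj_mat A * A * ?B"
    using adj_mat(1)[OF A] A B by (simp add: assoc_mult_mat)
  also have "\<dots> = det A \<cdot>\<^sub>m ?B"
    using adj_mat[OF A] A B by (simp add: mult_smult_assoc_mat[of _ n n])
  finally show ?thesis .
qed

section \<open>Invariant factors\<close>

lemma fps_to_fls_hom: "comm_ring_hom fps_to_fls"
  by unfold_locales (auto simp: fls_times_fps_to_fls)

lemma fps_to_fls_regpart:
  "f = 0 \<or> 0 \<le> fls_subdegree f \<Longrightarrow> fps_to_fls (fls_regpart f) = f"
  by auto

text \<open>Integrality is expressed with a separate alternative for zero, here and below, because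
  \<open>fls_subdegree 0 = 0\<close> says nothing about divisibility.\<close>

lemma fls_quotient_integral:
  fixes f p :: "'a::field fls"
  assumes "p \<noteq> 0" "f = 0 \<or> fls_subdegree p \<le> fls_subdegree f"
  shows "f / p = 0 \<or> 0 \<le> fls_subdegree (f / p)"
  using assms by (cases "f = 0") (auto simp: fls_divide_subdegree)

section \<open>Reduction to diagonal form by row and column operations over
  \<open>k[[t]]\<close>\<close>

text \<open>Equality of double cosets of \<open>GL_n(k[[t]])\<close>, isolated from
  \<open>is_invariant_factors\<close> so that reduction steps can be chained.\<close>

definition fps_equivalent :: "nat \<Rightarrow> 'a::field fls mat \<Rightarrow> 'a fls mat \<Rightarrow> bool" where
  "fps_equivalent n x y \<longleftrightarrow>
     (\<exists>g\<in>GL n. \<exists>h\<in>GL n. map_mat fps_to_fls g * x * map_mat fps_to_fls h = y)"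

lemma fps_equivalent_trans:
  assumes "fps_equivalent n x y" "fps_equivalent n y z" "x \<in> carrier_mat n n"
  shows "fps_equivalent n x z"
proof -
  interpret comm_ring_hom "fps_to_fls :: 'a fps \<Rightarrow> 'a fls"
    by (rule fps_to_fls_hom)
  obtain g h g' h' where gh: "g \<in> GL n" "h \<in> GL n" "map_mat fps_to_fls g * x * map_mat fps_to_fls h = y"
    and gh': "g' \<in> GL n" "h' \<in> GL n" "map_mat fps_to_fls g' * y * map_mat fps_to_fls h' = z"
    using assms by (auto simp: fps_equivalent_def)
  note carrier = gh(1,2)[THEN GL_carrier] gh'(1,2)[THEN GL_carrier]
  have "map_mat fps_to_fls (g' * g) * x * map_mat fps_to_fls (h * h') = z"
    using carrier assms(3)
    by (simp add: mat_hom_mult[of _ n n _ n] assoc_mult_mat[of _ n n _ n _ n] flip: gh(3) gh'(3))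
  thus ?thesis
    using gh gh' by (auto simp: fps_equivalent_def intro!: GL_mult bexI)
qed

lemma fps_equivalent_det:
  assumes "fps_equivalent n x y" "x \<in> carrier_mat n n" "det x \<noteq> 0"
  shows "det y \<noteq> 0"
proof -
  interpret comm_ring_hom "fps_to_fls :: 'a fps \<Rightarrow> 'a fls"
    by (rule fps_to_fls_hom)
  obtain g h where gh: "g \<in> GL n" "h \<in> GL n" "map_mat fps_to_fls g * x * map_mat fps_to_fls h = y"
    using assms by (auto simp: fps_equivalent_def)
  note GL = gh(1,2)[THEN hom_GL]
  have "det (map_mat fps_to_fls g) \<noteq> 0" "det (map_mat fps_to_fls h) \<noteq> 0"
    using GL[unfolded GL_field_iff] by blast+
  thus ?thesis
    using GL[THEN GL_carrier] assms(2,3)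
    by (simp add: det_mult[of _ n] gh(3)[symmetric] del: hom_det)
qed

lemma swaprows_mat_GL: "k < n \<Longrightarrow> l < n \<Longrightarrow> swaprows_mat n k l \<in> GL n"
  by (auto simp: GL_iff swaprows_mat_inv intro!: bexI[of _ "swaprows_mat n k l"])

text \<open>Brings the entry at \<open>(a, b)\<close> to the diagonal position
  \<open>(c, c)\<close>. Transposition matrices are their own inverses and have entries 0 and 1, so
  they exist over \<open>k[[t]]\<close>.\<close>

lemma fps_equivalent_swap:
  assumes "x \<in> carrier_mat n n" "a < n" "b < n" "c < n"
  shows "fps_equivalent n x (swapcols b c (swaprows a c x))"
proof -
  have map: "map_mat fps_to_fls (swaprows_mat n k l) = swaprows_mat n k l" for k l
    by (intro eq_matI) (auto simp: swaprows_mat_def)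
  have "swaprows_mat n a c * x \<in> carrier_mat n n"
    using assms(1) by (intro mult_carrier_mat) auto
  hence "swapcols b c (swaprows a c x) = swaprows_mat n a c * x * swaprows_mat n b c"
    using assms by (simp add: swaprows_mat[of _ n n] swapcols_mat[of _ n n])
  thus ?thesis
    unfolding fps_equivalent_def using assms
    by (metis map swaprows_mat_GL)
qed

text \<open>The upper left block becomes the Schur complement of the pivot \<open>p\<close>. The
  multipliers \<open>- B / p\<close> and \<open>- C / p\<close> are integral by the bounds on
  orders, so \<open>fls_regpart\<close> lifts them faithfully to \<open>k[[t]]\<close>; the block
  unitriangular matrices built from them have determinant 1.\<close>

lemma fps_equivalent_eliminate:
  fixes A :: "'a::field fls mat"
  assumes A: "A \<in> carrier_mat n n" and B: "B \<in> carrier_mat n 1" and C: "C \<in> carrier_mat 1 n"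
    and p: "p \<noteq> 0"
    and B_div: "\<And>i. i < n \<Longrightarrow> B $$ (i, 0) = 0 \<or> fls_subdegree p \<le> fls_subdegree (B $$ (i, 0))"
    and C_div: "\<And>j. j < n \<Longrightarrow> C $$ (0, j) = 0 \<or> fls_subdegree p \<le> fls_subdegree (C $$ (0, j))"
  shows "fps_equivalent (n + 1) (four_block_mat A B C (mat 1 1 (\<lambda>_. p)))
    (four_block_mat (mat n n (\<lambda>(i, j). A $$ (i, j) - B $$ (i, 0) * C $$ (0, j) / p))
       (0\<^sub>m n 1) (0\<^sub>m 1 n) (mat 1 1 (\<lambda>_. p)))" (is "fps_equivalent _ ?x ?y")
proof -
  define u where "u = mat n 1 (\<lambda>(i, j). fls_regpart (- B $$ (i, 0) / p))"
  define v where "v = mat 1 n (\<lambda>(i, j). fls_regpart (- C $$ (0, j) / p))"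
  define g where "g = four_block_mat (1\<^sub>m n) u (0\<^sub>m 1 n) (1\<^sub>m 1)"
  define h where "h = four_block_mat (1\<^sub>m n) (0\<^sub>m n 1) v (1\<^sub>m 1)"
  have [simp]: "u \<in> carrier_mat n 1" "v \<in> carrier_mat 1 n"
    by (auto simp: u_def v_def)
  have "g \<in> carrier_mat (n + 1) (n + 1)" "h \<in> carrier_mat (n + 1) (n + 1)"
    by (auto simp: g_def h_def)
  moreover have "det g = 1"
    unfolding g_def by (subst det_four_block_mat_lower_left_zero[of _ n _ 1]) (simp_all del: One_nat_def)
  moreover have "det h = 1"
    unfolding h_def by (subst det_four_block_mat_upper_right_zero[of _ n _ 1]) (simp_all del: One_nat_def)
  ultimately have gh: "g \<in> GL (n + 1)" "h \<in> GL (n + 1)"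
    by (auto simp: GL_iff_det_unit)
  let ?u = "mat n 1 (\<lambda>(i, j). - B $$ (i, 0) / p)" and ?v = "mat 1 n (\<lambda>(i, j). - C $$ (0, j) / p)"
  have u: "map_mat fps_to_fls u = ?u"
  proof (rule eq_matI)
    fix i j assume "i < dim_row ?u" "j < dim_col ?u"
    moreover from this have "fps_to_fls (fls_regpart (- B $$ (i, 0) / p)) = - B $$ (i, 0) / p"
      using B_div[of i] by (intro fps_to_fls_regpart fls_quotient_integral p) auto
    ultimately show "map_mat fps_to_fls u $$ (i, j) = ?u $$ (i, j)"
      by (simp add: u_def)
  qed (auto simp: u_def)
  have v: "map_mat fps_to_fls v = ?v"
  proof (rule eq_matI)
    fix i j assume "i < dim_row ?v" "j < dim_col ?v"
    moreover from this have "fps_to_fls (fls_regpart (- C $$ (0, j) / p)) = - C $$ (0, j) / p"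
      using C_div[of j] by (intro fps_to_fls_regpart fls_quotient_integral p) auto
    ultimately show "map_mat fps_to_fls v $$ (i, j) = ?v $$ (i, j)"
      by (simp add: v_def)
  qed (auto simp: v_def)
  interpret comm_ring_hom "fps_to_fls :: 'a fps \<Rightarrow> 'a fls"
    by (rule fps_to_fls_hom)
  have g': "map_mat fps_to_fls g = four_block_mat (1\<^sub>m n) ?u (0\<^sub>m 1 n) (1\<^sub>m 1)"
    unfolding g_def u[symmetric]
    by (subst map_four_block_mat[of _ n n _ 1 _ 1]) (auto simp: mat_hom_one simp del: One_nat_def)
  have h': "map_mat fps_to_fls h = four_block_mat (1\<^sub>m n) (0\<^sub>m n 1) ?v (1\<^sub>m 1)"
    unfolding h_def v[symmetric]
    by (subst map_four_block_mat[of _ n n _ 1 _ 1]) (auto simp: mat_hom_one simp del: One_nat_def)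
  have "map_mat fps_to_fls g * ?x =
      four_block_mat (A + ?u * C) (0\<^sub>m n 1) C (mat 1 1 (\<lambda>_. p))"
    unfolding g' using A B C p
    by (subst mult_four_block_mat[of _ n n _ 1 _ 1 _ _ n _ 1])
       (auto intro!: cong_four_block_mat eq_matI simp: scalar_prod_def)
  also have "\<dots> * map_mat fps_to_fls h =
      four_block_mat (A + ?u * C) (0\<^sub>m n 1) (0\<^sub>m 1 n) (mat 1 1 (\<lambda>_. p))"
    unfolding h' using A B C p
    by (subst mult_four_block_mat[of _ n n _ 1 _ 1 _ _ n _ 1])
       (auto intro!: cong_four_block_mat eq_matI simp: scalar_prod_def)
  also have "A + ?u * C = mat n n (\<lambda>(i, j). A $$ (i, j) - B $$ (i, 0) * C $$ (0, j) / p)"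
    using A B C by (intro eq_matI) (auto simp: scalar_prod_def)
  finally show ?thesis
    using gh unfolding fps_equivalent_def by blast
qed

text \<open>Elements of equal order differ by the unit \<open>q / p\<close> of
  \<open>k[[t]]\<close>. This extends a reduction of the block \<open>S\<close> and at the same time
  normalizes the pivot to a power of \<open>t\<close>.\<close>

lemma fps_equivalent_block:
  fixes S :: "'a::field fls mat"
  assumes "fps_equivalent n S S'" "S \<in> carrier_mat n n"
    and "p \<noteq> 0" "q \<noteq> 0" "fls_subdegree p = fls_subdegree q"
  shows "fps_equivalent (n + 1) (four_block_mat S (0\<^sub>m n 1) (0\<^sub>m 1 n) (mat 1 1 (\<lambda>_. p)))
    (four_block_mat S' (0\<^sub>m n 1) (0\<^sub>m 1 n) (mat 1 1 (\<lambda>_. q)))" (is "fps_equivalent _ ?x ?y")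
proof -
  interpret comm_ring_hom "fps_to_fls :: 'a fps \<Rightarrow> 'a fls"
    by (rule fps_to_fls_hom)
  obtain g h where gh: "g \<in> GL n" "h \<in> GL n" "map_mat fps_to_fls g * S * map_mat fps_to_fls h = S'"
    using assms(1) by (auto simp: fps_equivalent_def)
  note carrier = gh(1,2)[THEN GL_carrier]
  define w where "w = fls_regpart (q / p)"
  have w: "fps_to_fls w = q / p"
    unfolding w_def by (rule fps_to_fls_regpart) (use assms in \<open>auto simp: fls_divide_subdegree\<close>)
  have w': "fps_to_fls (fls_regpart (p / q)) = p / q"
    by (rule fps_to_fls_regpart) (use assms in \<open>auto simp: fls_divide_subdegree\<close>)
  have "fps_to_fls (w * fls_regpart (p / q)) = 1"
    unfolding hom_mult w w' using assms by simp
  hence unit: "w dvd 1"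
    by (metis dvdI fps_to_fls_eq_1_iff)
  define G where "G = four_block_mat g (0\<^sub>m n 1) (0\<^sub>m 1 n) (1\<^sub>m 1)"
  define H where "H = four_block_mat h (0\<^sub>m n 1) (0\<^sub>m 1 n) (mat 1 1 (\<lambda>_. w))"
  have det: "det (mat 1 1 (\<lambda>_. w)) = w"
    by (subst det_single) auto
  have "det G = det g" "det H = det h * w"
    unfolding G_def H_def using carrier det
    by (subst det_four_block_mat_lower_left_zero[of _ n _ 1]; simp)+
  moreover have "G \<in> carrier_mat (n + 1) (n + 1)" "H \<in> carrier_mat (n + 1) (n + 1)"
    using carrier by (auto simp: G_def H_def)
  moreover have "det h * w dvd 1"
    using mult_dvd_mono[OF GL_det_unit[OF gh(2)] unit] by simp
  ultimately have "G \<in> GL (n + 1)" "H \<in> GL (n + 1)"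
    using GL_det_unit[OF gh(1)] by (simp_all only: GL_iff_det_unit)
  moreover have "map_mat fps_to_fls G * ?x * map_mat fps_to_fls H = ?y"
  proof -
    have "map_mat fps_to_fls G = four_block_mat (map_mat fps_to_fls g) (0\<^sub>m n 1) (0\<^sub>m 1 n) (1\<^sub>m 1)"
      unfolding G_def using carrier
      by (subst map_four_block_mat[of _ n n _ 1 _ 1]) (auto simp: mat_hom_one)
    hence "map_mat fps_to_fls G * ?x =
        four_block_mat (map_mat fps_to_fls g * S) (0\<^sub>m n 1) (0\<^sub>m 1 n) (mat 1 1 (\<lambda>_. p))"
      using carrier assms(2)
      by (simp, subst mult_four_block_mat[of _ n n _ 1 _ 1 _ _ n _ 1])
         (auto intro!: cong_four_block_mat)
    moreover have "map_mat fps_to_fls H = four_block_mat (map_mat fps_to_fls h) (0\<^sub>m n 1) (0\<^sub>m 1 n) (mat 1 1 (\<lambda>_. q / p))"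
      unfolding H_def using carrier
      by (subst map_four_block_mat[of _ n n _ 1 _ 1]) (auto intro!: cong_four_block_mat eq_matI simp: w)
    moreover have "four_block_mat (map_mat fps_to_fls g * S) (0\<^sub>m n 1) (0\<^sub>m 1 n) (mat 1 1 (\<lambda>_. p)) *
        four_block_mat (map_mat fps_to_fls h) (0\<^sub>m n 1) (0\<^sub>m 1 n) (mat 1 1 (\<lambda>_. q / p)) = ?y"
      using carrier assms(2-) gh(3)
      by (subst mult_four_block_mat[of _ n n _ 1 _ 1 _ _ n _ 1])
         (auto intro!: cong_four_block_mat eq_matI simp: scalar_prod_def)
    ultimately show ?thesis by simp
  qed
  ultimately show ?thesis
    unfolding fps_equivalent_def by blast
qed

lemma fls_subdegree_minus_ge:
  fixes f g :: "'a::ab_group_add fls"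
  assumes "f = 0 \<or> e \<le> fls_subdegree f" "g = 0 \<or> e \<le> fls_subdegree g"
  shows "f - g = 0 \<or> e \<le> fls_subdegree (f - g)"
proof -
  have "fls_nth (f - g) k = 0" if "k < e" for k
    using assms that by (auto simp: fls_eq0_below_subdegree)
  thus ?thesis
    by (metis fls_subdegree_geI)
qed

lemma fls_pivot_exists:
  fixes x :: "'a::field fls mat"
  assumes "x \<in> carrier_mat n n" "det x \<noteq> 0" "n > 0"
  obtains a b where "a < n" "b < n" "x $$ (a, b) \<noteq> 0"
    "\<And>i j. i < n \<Longrightarrow> j < n \<Longrightarrow> x $$ (i, j) = 0 \<or> fls_subdegree (x $$ (a, b)) \<le> fls_subdegree (x $$ (i, j))"
proof -
  let ?N = "{(i, j) \<in> {..<n} \<times> {..<n}. x $$ (i, j) \<noteq> 0}"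
  have "?N \<noteq> {}"
  proof
    assume "?N = {}"
    hence "x = 0\<^sub>m n n"
      using assms(1) by (intro eq_matI) auto
    thus False
      using assms(2,3) by simp
  qed
  moreover have "finite ?N"
    by (rule finite_subset[of _ "{..<n} \<times> {..<n}"]) auto
  ultimately obtain ab where "ab \<in> ?N" "\<And>ij. ij \<in> ?N \<Longrightarrow> fls_subdegree (x $$ ab) \<le> fls_subdegree (x $$ ij)"
    using ex_is_arg_min_if_finite[of ?N "\<lambda>ij. fls_subdegree (x $$ ij)"]
    by (auto simp: is_arg_min_linorder)
  thus ?thesis
    by (intro that[of "fst ab" "snd ab"]) fastforce+
qed

text \<open>Gaussian elimination with an entry of least order as pivot, placed in the last diagonal
  position. The bound \<open>d\<close> is carried along because the recursive call must return
  exponents at least the order of the pivot: only then is the sequence still decreasing after that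
  order is appended.\<close>

lemma invariant_factors_exist_aux:
  fixes x :: "'a::field fls mat"
  assumes "x \<in> carrier_mat n n" "det x \<noteq> 0"
    and "\<And>i j. i < n \<Longrightarrow> j < n \<Longrightarrow> x $$ (i, j) = 0 \<or> d \<le> fls_subdegree (x $$ (i, j))"
  shows "\<exists>\<alpha>. fps_equivalent n x (mat_diag n (\<lambda>i. fls_X_intpow (\<alpha> i))) \<and>
    (\<forall>i j. i \<le> j \<longrightarrow> j < n \<longrightarrow> \<alpha> j \<le> \<alpha> i) \<and> (\<forall>i<n. d \<le> \<alpha> i)"
  using assms
proof (induction n arbitrary: x d)
  case 0
  have "fps_equivalent 0 x (mat_diag 0 (\<lambda>i. fls_X_intpow 0))"
    using 0 unfolding fps_equivalent_def
    by (intro bexI[of _ "1\<^sub>m 0"]) (auto simp: GL_one intro!: eq_matI)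
  thus ?case by (intro exI[of _ "\<lambda>_. 0"]) simp
next
  case (Suc n)
  obtain a b where ab: "a < Suc n" "b < Suc n" "x $$ (a, b) \<noteq> 0" and
    min: "\<And>i j. i < Suc n \<Longrightarrow> j < Suc n \<Longrightarrow>
      x $$ (i, j) = 0 \<or> fls_subdegree (x $$ (a, b)) \<le> fls_subdegree (x $$ (i, j))"
    using fls_pivot_exists[OF Suc.prems(1,2)] by blast
  define p where "p = x $$ (a, b)"
  define e where "e = fls_subdegree p"
  have p: "p \<noteq> 0" and "d \<le> e"
    using Suc.prems(3)[OF ab(1,2)] ab(3) by (auto simp: p_def e_def)
  define y where "y = swapcols b n (swaprows a n x)"
  have y: "y \<in> carrier_mat (n + 1) (n + 1)" "y $$ (n, n) = p"
    using Suc.prems(1) ab by (auto simp: y_def p_def)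
  have equiv_xy: "fps_equivalent (Suc n) x y"
    unfolding y_def using Suc.prems(1) ab by (intro fps_equivalent_swap) auto
  have y_min: "y $$ (i, j) = 0 \<or> e \<le> fls_subdegree (y $$ (i, j))" if "i < Suc n" "j < Suc n" for i j
    unfolding y_def e_def p_def using Suc.prems(1) that ab min by auto
  define A where "A = mat n n (\<lambda>ij. y $$ ij)"
  define B where "B = mat n 1 (\<lambda>(i, j). y $$ (i, n))"
  define C where "C = mat 1 n (\<lambda>(i, j). y $$ (n, j))"
  define S where "S = mat n n (\<lambda>(i, j). A $$ (i, j) - B $$ (i, 0) * C $$ (0, j) / p)"
  have ABC: "A \<in> carrier_mat n n" "B \<in> carrier_mat n 1" "C \<in> carrier_mat 1 n" "S \<in> carrier_mat n n"
    by (auto simp: A_def B_def C_def S_def)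
  have "y = four_block_mat A B C (mat 1 1 (\<lambda>_. p))"
    using y by (intro eq_matI) (auto simp: A_def B_def C_def less_Suc_eq)
  moreover have "fps_equivalent (n + 1) (four_block_mat A B C (mat 1 1 (\<lambda>_. p)))
      (four_block_mat S (0\<^sub>m n 1) (0\<^sub>m 1 n) (mat 1 1 (\<lambda>_. p)))"
    unfolding S_def using ABC p y_min
    by (intro fps_equivalent_eliminate) (auto simp: B_def C_def e_def)
  ultimately have equiv_S: "fps_equivalent (Suc n) x (four_block_mat S (0\<^sub>m n 1) (0\<^sub>m 1 n) (mat 1 1 (\<lambda>_. p)))"
    using equiv_xy Suc.prems(1) by (auto intro: fps_equivalent_trans)
  have "det (four_block_mat S (0\<^sub>m n 1) (0\<^sub>m 1 n) (mat 1 1 (\<lambda>_. p))) \<noteq> 0"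
    using fps_equivalent_det[OF equiv_S] Suc.prems by simp
  hence "det S \<noteq> 0"
    using ABC by (auto simp: det_four_block_mat_lower_left_zero[of _ n _ 1])
  \<comment> \<open>The correction term has order at least \<open>e + e - e\<close>, so the Schur
    complement inherits the bound \<open>e\<close>, and the induction hypothesis is used with
    \<open>e\<close> in place of \<open>d\<close>.\<close>
  moreover have "S $$ (i, j) = 0 \<or> e \<le> fls_subdegree (S $$ (i, j))" if ij: "i < n" "j < n" for i j
  proof -
    have "y $$ (i, n) * y $$ (n, j) / p = 0 \<or> e \<le> fls_subdegree (y $$ (i, n) * y $$ (n, j) / p)"
      using y_min[of i n] y_min[of n j] ij p
      by (cases "y $$ (n, j) = 0"; cases "y $$ (i, n) = 0") (auto simp: fls_divide_subdegree e_def)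
    thus ?thesis
      using fls_subdegree_minus_ge[OF y_min[of i j]] ij by (simp add: S_def A_def B_def C_def)
  qed
  ultimately have "\<exists>\<alpha>. fps_equivalent n S (mat_diag n (\<lambda>i. fls_X_intpow (\<alpha> i))) \<and>
      (\<forall>i j. i \<le> j \<longrightarrow> j < n \<longrightarrow> \<alpha> j \<le> \<alpha> i) \<and> (\<forall>i<n. e \<le> \<alpha> i)"
    by (intro Suc.IH ABC)
  then obtain \<alpha> where \<alpha>: "fps_equivalent n S (mat_diag n (\<lambda>i. fls_X_intpow (\<alpha> i)))"
    "\<And>i j. i \<le> j \<Longrightarrow> j < n \<Longrightarrow> \<alpha> j \<le> \<alpha> i" "\<And>i. i < n \<Longrightarrow> e \<le> \<alpha> i"
    by blast
  define \<alpha>' where "\<alpha>' i = (if i < n then \<alpha> i else e)" for i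
  have "fps_equivalent (Suc n) (four_block_mat S (0\<^sub>m n 1) (0\<^sub>m 1 n) (mat 1 1 (\<lambda>_. p)))
      (four_block_mat (mat_diag n (\<lambda>i. fls_X_intpow (\<alpha> i))) (0\<^sub>m n 1) (0\<^sub>m 1 n) (mat 1 1 (\<lambda>_. fls_X_intpow e)))"
    unfolding Suc_eq_plus1
    by (rule fps_equivalent_block[OF \<alpha>(1) ABC(4) p fls_X_intpow_nonzero])
       (simp only: e_def fls_subdegree_fls_X_intpow)
  also have "four_block_mat (mat_diag n (\<lambda>i. fls_X_intpow (\<alpha> i))) (0\<^sub>m n 1) (0\<^sub>m 1 n) (mat 1 1 (\<lambda>_. fls_X_intpow e)) =
      (mat_diag (Suc n) (\<lambda>i. fls_X_intpow (\<alpha>' i)) :: 'a fls mat)"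
    by (intro eq_matI) (auto simp: mat_diag_def \<alpha>'_def less_Suc_eq)
  finally have "fps_equivalent (Suc n) x (mat_diag (Suc n) (\<lambda>i. fls_X_intpow (\<alpha>' i)))"
    by (rule fps_equivalent_trans[OF equiv_S _ Suc.prems(1)])
  moreover have "\<alpha>' j \<le> \<alpha>' i" if "i \<le> j" "j < Suc n" for i j
    using that \<alpha>(2,3) by (auto simp: \<alpha>'_def)
  moreover have "d \<le> \<alpha>' i" if "i < Suc n" for i
    using that \<alpha>(3)[of i] \<open>d \<le> e\<close> by (auto simp: \<alpha>'_def)
  ultimately show ?case by blast
qed

lemma invariant_factors_exist:
  fixes x :: "'a::field fls mat"
  assumes "x \<in> GL n"
  shows "\<exists>\<alpha>. is_invariant_factors n x \<alpha>"
proof -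
  let ?E = "insert 0 ((\<lambda>ij. fls_subdegree (x $$ ij)) ` ({..<n} \<times> {..<n}))"
  have "\<exists>\<alpha>. fps_equivalent n x (mat_diag n (\<lambda>i. fls_X_intpow (\<alpha> i))) \<and>
      (\<forall>i j. i \<le> j \<longrightarrow> j < n \<longrightarrow> \<alpha> j \<le> \<alpha> i) \<and> (\<forall>i<n. Min ?E \<le> \<alpha> i)"
    by (rule invariant_factors_exist_aux) (use assms in \<open>auto simp: GL_field_iff intro!: Min_le\<close>)
  then obtain \<alpha> where \<alpha>: "fps_equivalent n x (mat_diag n (\<lambda>i. fls_X_intpow (\<alpha> i)))"
      "\<And>i j. i \<le> j \<Longrightarrow> j < n \<Longrightarrow> \<alpha> j \<le> \<alpha> i"
    by blast
  moreover have "mat_diag n (\<lambda>i. fls_X_intpow (vec n \<alpha> $ i)) = (mat_diag n (\<lambda>i. fls_X_intpow (\<alpha> i)) :: 'a fls mat)"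
    by (intro eq_matI) (auto simp: mat_diag_def)
  ultimately have "is_invariant_factors n x (vec n \<alpha>)"
    unfolding is_invariant_factors_def fps_equivalent_def by simp
  thus ?thesis ..
qed

section \<open>Polynomial functions on pairs of matrices\<close>

text \<open>The condition concerns matrices of the right size only, so that functions given by
  \<open>det\<close> or \<open>adj_mat\<close> can be recognized as polynomial through closure
  rules, without exhibiting a polynomial.\<close>

definition polyfun2 :: "nat \<Rightarrow> ('a::field mat \<Rightarrow> 'a mat \<Rightarrow> 'a) \<Rightarrow> bool" where
  "polyfun2 n F \<longleftrightarrow> (\<exists>p\<in>mpolys (mat_vars n <+> mat_vars n).
     \<forall>g\<in>carrier_mat n n. \<forall>h\<in>carrier_mat n n.
       F g h = mpoly_eval (\<lambda>c. c) (case_sum (($$) g) (($$) h)) p)"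

lemma id_hom: "comm_ring_hom (\<lambda>c. c)"
  by unfold_locales auto

lemma polyfun2I:
  assumes "p \<in> mpolys (mat_vars n <+> mat_vars n)"
    and "\<And>g h. g \<in> carrier_mat n n \<Longrightarrow> h \<in> carrier_mat n n \<Longrightarrow>
       F g h = mpoly_eval (\<lambda>c. c) (case_sum (($$) g) (($$) h)) p"
  shows "polyfun2 n F"
  using assms unfolding polyfun2_def by blast

lemma polyfun2E:
  assumes "polyfun2 n F"
  obtains p where "p \<in> mpolys (mat_vars n <+> mat_vars n)"
    "\<And>g h. g \<in> carrier_mat n n \<Longrightarrow> h \<in> carrier_mat n n \<Longrightarrow>
       F g h = mpoly_eval (\<lambda>c. c) (case_sum (($$) g) (($$) h)) p"
  using assms unfolding polyfun2_def by blast

lemma polyfun2_cong: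
  assumes "polyfun2 n F" "\<And>g h. g \<in> carrier_mat n n \<Longrightarrow> h \<in> carrier_mat n n \<Longrightarrow> F g h = F' g h"
  shows "polyfun2 n F'"
proof -
  obtain p where p: "p \<in> mpolys (mat_vars n <+> mat_vars n)"
    "\<And>g h. g \<in> carrier_mat n n \<Longrightarrow> h \<in> carrier_mat n n \<Longrightarrow>
       F g h = mpoly_eval (\<lambda>c. c) (case_sum (($$) g) (($$) h)) p"
    using polyfun2E[OF assms(1)] by blast
  show ?thesis
    by (rule polyfun2I[OF p(1)]) (simp only: p(2) assms(2)[symmetric])
qed

lemma polyfun2_const: "polyfun2 n (\<lambda>g h. c)"
  by (rule polyfun2I[OF mpolys_const]) (rule comm_ring_hom.mpoly_eval_const[OF id_hom, symmetric])

lemma polyfun2_entry1: "i < n \<Longrightarrow> j < n \<Longrightarrow> polyfun2 n (\<lambda>g h. g $$ (i, j))"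
  by (rule polyfun2I[OF mpolys_var[of "Inl (i, j)"]])
     (auto simp: comm_ring_hom.mpoly_eval_var[OF id_hom])

lemma polyfun2_entry2: "i < n \<Longrightarrow> j < n \<Longrightarrow> polyfun2 n (\<lambda>g h. h $$ (i, j))"
  by (rule polyfun2I[OF mpolys_var[of "Inr (i, j)"]])
     (auto simp: comm_ring_hom.mpoly_eval_var[OF id_hom])

lemma polyfun2_add:
  assumes "polyfun2 n F" "polyfun2 n F'"
  shows "polyfun2 n (\<lambda>g h. F g h + F' g h)"
  by (rule polyfun2E[OF assms(1)], rule polyfun2E[OF assms(2)], rule polyfun2I[OF mpolys_add], assumption+)
     (simp only: comm_ring_hom.mpoly_eval_add[OF id_hom])

lemma polyfun2_mult:
  assumes "polyfun2 n F" "polyfun2 n F'"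
  shows "polyfun2 n (\<lambda>g h. F g h * F' g h)"
  by (rule polyfun2E[OF assms(1)], rule polyfun2E[OF assms(2)], rule polyfun2I[OF mpolys_mult], assumption+)
     (simp only: comm_ring_hom.mpoly_eval_mult[OF id_hom])

lemma polyfun2_sum:
  "(\<And>i. i \<in> I \<Longrightarrow> polyfun2 n (F i)) \<Longrightarrow> polyfun2 n (\<lambda>g h. \<Sum>i\<in>I. F i g h)"
  by (induction I rule: infinite_finite_induct) (auto intro: polyfun2_add polyfun2_const)

lemma polyfun2_prod:
  "(\<And>i. i \<in> I \<Longrightarrow> polyfun2 n (F i)) \<Longrightarrow> polyfun2 n (\<lambda>g h. \<Prod>i\<in>I. F i g h)"
  by (induction I rule: infinite_finite_induct) (auto intro: polyfun2_mult polyfun2_const)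

lemma polyfun2_det:
  assumes "\<And>i j. i < m \<Longrightarrow> j < m \<Longrightarrow> polyfun2 n (\<lambda>g h. F g h i j)"
  shows "polyfun2 n (\<lambda>g h. det (mat m m (\<lambda>(i, j). F g h i j)))"
proof -
  have "polyfun2 n (\<lambda>g h. \<Sum>p | p permutes {0..<m}. signof p * (\<Prod>i = 0..<m. F g h i (p i)))"
    by (intro polyfun2_sum polyfun2_mult polyfun2_const polyfun2_prod)
       (auto intro!: assms simp: permutes_in_image)
  thus ?thesis
    by (rule polyfun2_cong) (auto simp: det_def permutes_in_image intro!: sum.cong prod.cong)
qed

lemma polyfun2_adj_mat:
  assumes "i < n" "j < n"
  shows "polyfun2 n (\<lambda>g h. adj_mat g $$ (i, j))"
proof -
  \<comment> \<open>\<open>?s k\<close> enumerates the indices other than \<open>k\<close>, as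
    \<open>mat_delete\<close> does. The row index \<open>j\<close> and the column index
    \<open>i\<close> are deleted, since the adjugate is the transposed cofactor matrix.\<close>
  let ?s = "\<lambda>k l. if l < k then l else Suc l"
  have "polyfun2 n (\<lambda>g h. (-1) ^ (j + i) * det (mat (n - 1) (n - 1) (\<lambda>(a, b). g $$ (?s j a, ?s i b))))"
    using assms by (intro polyfun2_mult polyfun2_const polyfun2_det) (auto intro: polyfun2_entry1)
  thus ?thesis
    by (rule polyfun2_cong) (use assms in \<open>auto simp: adj_mat_def cofactor_def mat_delete_def\<close>)
qed

section \<open>Open sets of pairs, and irreducibility\<close>

lemma zopen_GL2_nonzero:
  assumes "polyfun2 n F"
  shows "zopen_GL2 n {(g, h) \<in> GL n \<times> GL n. F g h \<noteq> 0}"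
proof -
  obtain p where p: "p \<in> mpolys (mat_vars n <+> mat_vars n)"
    "\<And>g h. g \<in> carrier_mat n n \<Longrightarrow> h \<in> carrier_mat n n \<Longrightarrow>
       F g h = mpoly_eval (\<lambda>c. c) (case_sum (($$) g) (($$) h)) p"
    using polyfun2E[OF assms] by blast
  show ?thesis
    unfolding zopen_GL2_def zclosed_GL2_def using p
    by (intro conjI exI[of _ "{p}"]) (auto simp: GL_carrier)
qed

lemma polyfun2_line:
  assumes "polyfun2 n F" "g \<in> carrier_mat n n" "h \<in> carrier_mat n n"
    "g' \<in> carrier_mat n n" "h' \<in> carrier_mat n n"
  shows "\<exists>P. \<forall>s. poly P s = F (g + s \<cdot>\<^sub>m (g' - g)) (h + s \<cdot>\<^sub>m (h' - h))"
proof -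
  obtain p where p: "p \<in> mpolys (mat_vars n <+> mat_vars n)"
    "\<And>g h. g \<in> carrier_mat n n \<Longrightarrow> h \<in> carrier_mat n n \<Longrightarrow>
       F g h = mpoly_eval (\<lambda>c. c) (case_sum (($$) g) (($$) h)) p"
    using polyfun2E[OF assms(1)] by blast
  let ?a = "case_sum (($$) g) (($$) h)" and ?b = "case_sum (($$) g') (($$) h')"
  obtain P where P: "poly P s = mpoly_eval (\<lambda>c. c) (\<lambda>v. ?a v + s * (?b v - ?a v)) p" for s
    using mpoly_eval_line[of ?a ?b p] by blast
  have "poly P s = F (g + s \<cdot>\<^sub>m (g' - g)) (h + s \<cdot>\<^sub>m (h' - h))" for s
    unfolding P using assms
    by (subst p(2)) (auto intro!: mpoly_eval_cong[OF p(1)])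
  thus ?thesis by blast
qed

text \<open>A point of \<open>U\<close> violates one of the equations of the complement; the
  nonvanishing locus of that equation is a basic open neighbourhood inside \<open>U\<close>.\<close>

lemma zopen_GL2_obtain:
  assumes "zopen_GL2 n U" "U \<noteq> {}"
  obtains F g h where "polyfun2 n F" "g \<in> GL n" "h \<in> GL n" "F g h \<noteq> 0"
    "\<And>g h. g \<in> GL n \<Longrightarrow> h \<in> GL n \<Longrightarrow> F g h \<noteq> 0 \<Longrightarrow> (g, h) \<in> U"
proof -
  obtain S where S: "S \<subseteq> mpolys (mat_vars n <+> mat_vars n)"
    "GL n \<times> GL n - U = {(g, h) \<in> GL n \<times> GL n.
       \<forall>p\<in>S. mpoly_eval (\<lambda>c. c) (case_sum (($$) g) (($$) h)) p = 0}"
    using assms(1) by (auto simp: zopen_GL2_def zclosed_GL2_def)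
  obtain g h where gh: "g \<in> GL n" "h \<in> GL n" "(g, h) \<in> U"
    using assms by (auto simp: zopen_GL2_def)
  have "(g, h) \<notin> GL n \<times> GL n - U"
    using gh by simp
  then obtain p where p: "p \<in> S" "mpoly_eval (\<lambda>c. c) (case_sum (($$) g) (($$) h)) p \<noteq> 0"
    unfolding S(2) using gh by auto
  let ?F = "\<lambda>g h. mpoly_eval (\<lambda>c. c) (case_sum (($$) g) (($$) h)) p"
  have "polyfun2 n ?F"
    by (rule polyfun2I) (use p S(1) in auto)
  moreover have "(g, h) \<in> U" if "g \<in> GL n" "h \<in> GL n" "?F g h \<noteq> 0" for g h
  proof -
    have "(g, h) \<notin> GL n \<times> GL n - U"
      unfolding S(2) using p(1) that(3) by auto
    thus ?thesis
      using that(1,2) by auto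
  qed
  ultimately show ?thesis
    using that[of ?F g h] gh(1,2) p(2) by blast
qed

text \<open>Irreducibility of \<open>GL_n \<times> GL_n\<close>, proved on the line through a point
  of \<open>U\<close> and a point of \<open>V\<close>: finitely many parameters are excluded, and
  the field is infinite.\<close>

lemma zopen_GL2_meet:
  fixes U V :: "('a::alg_closed_field mat \<times> 'a mat) set"
  assumes "zopen_GL2 n U" "U \<noteq> {}" "zopen_GL2 n V" "V \<noteq> {}"
  shows "U \<inter> V \<noteq> {}"
proof -
  obtain F g h where F: "polyfun2 n F" "g \<in> GL n" "h \<in> GL n" "F g h \<noteq> 0"
    "\<And>g h. g \<in> GL n \<Longrightarrow> h \<in> GL n \<Longrightarrow> F g h \<noteq> 0 \<Longrightarrow> (g, h) \<in> U"
    using zopen_GL2_obtain[OF assms(1,2)] by blast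
  obtain F' g' h' where F': "polyfun2 n F'" "g' \<in> GL n" "h' \<in> GL n" "F' g' h' \<noteq> 0"
    "\<And>g h. g \<in> GL n \<Longrightarrow> h \<in> GL n \<Longrightarrow> F' g h \<noteq> 0 \<Longrightarrow> (g, h) \<in> V"
    using zopen_GL2_obtain[OF assms(3,4)] by blast
  note carrier = F(2,3)[THEN GL_carrier] F'(2,3)[THEN GL_carrier]
  let ?g = "\<lambda>s. g + s \<cdot>\<^sub>m (g' - g)" and ?h = "\<lambda>s. h + s \<cdot>\<^sub>m (h' - h)"
  have ends: "?g 0 = g" "?h 0 = h" "?g 1 = g'" "?h 1 = h'"
    using carrier by (auto intro!: eq_matI)
  obtain P where P: "poly P s = F (?g s) (?h s)" for s
    using polyfun2_line[OF F(1) carrier] by blast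
  obtain P' where P': "poly P' s = F' (?g s) (?h s)" for s
    using polyfun2_line[OF F'(1) carrier] by blast
  \<comment> \<open>The line is taken in the space of all pairs of matrices; \<open>D\<close>
    detects where it leaves the invertible ones.\<close>
  have "polyfun2 n (\<lambda>g h. det g * det h)"
  proof (rule polyfun2_cong)
    show "polyfun2 n (\<lambda>g h. det (mat n n (\<lambda>(i, j). g $$ (i, j))) * det (mat n n (\<lambda>(i, j). h $$ (i, j))))"
      by (intro polyfun2_mult polyfun2_det polyfun2_entry1 polyfun2_entry2)
  qed (auto intro!: arg_cong2[where f = "(*)"] arg_cong[where f = det] eq_matI)
  then obtain D where D: "poly D s = det (?g s) * det (?h s)" for s
    using polyfun2_line[OF _ carrier] by blast
  \<comment> \<open>Parameter 0 is the chosen point of \<open>U\<close>, parameter 1 that of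
    \<open>V\<close>; hence none of the three polynomials is zero.\<close>
  have "poly P 0 \<noteq> 0" "poly P' 1 \<noteq> 0" "poly D 0 \<noteq> 0"
    unfolding P P' D ends using F F' by (auto simp: GL_field_iff)
  hence "P * P' * D \<noteq> 0"
    by auto
  hence "finite {s. poly (P * P' * D) s = 0}"
    by (rule poly_roots_finite)
  then obtain s where "poly (P * P' * D) s \<noteq> 0"
    using infinite_UNIV_alg_closed by (metis (mono_tags, lifting) UNIV_I finite_subset mem_Collect_eq subsetI)
  hence s: "F (?g s) (?h s) \<noteq> 0" "F' (?g s) (?h s) \<noteq> 0" "det (?g s) \<noteq> 0" "det (?h s) \<noteq> 0"
    by (auto simp: P P' D)
  hence "?g s \<in> GL n" "?h s \<in> GL n"
    using carrier by (auto simp: GL_field_iff)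
  hence "(?g s, ?h s) \<in> U \<inter> V"
    using F(5) F'(5) s by auto
  thus ?thesis by blast
qed

section \<open>Corner minors\<close>

lemma pick_atLeastLessThan:
  assumes "a < n - i"
  shows "pick {i..<n} a = i + a"
proof -
  have "{b \<in> {i..<n}. b < i + a} = {i..<i + a}"
    using assms by auto
  hence "pick {i..<n} (card {i..<i + a}) = i + a"
    using pick_card_in_set[of "i + a" "{i..<n}"] assms by simp
  thus ?thesis by simp
qed

text \<open>The value of \<open>corner_minor n i\<close> at a matrix over any commutative ring, with
  explicit indices in place of \<open>submatrix\<close>. For \<open>i \<ge> n\<close> the matrix is
  empty and the value is 1.\<close>

definition corner_det :: "nat \<Rightarrow> nat \<Rightarrow> 'a::comm_ring_1 mat \<Rightarrow> 'a" where
  "corner_det n i M = det (mat (n - i) (n - i) (\<lambda>(a, b). M $$ (i + a, i + b)))"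

lemma det_submatrix_corner:
  assumes "M \<in> carrier_mat n n"
  shows "det (submatrix M {i..<n} {i..<n}) = corner_det n i M"
proof -
  have "{j. j < n \<and> j \<in> {i..<n}} = {i..<n}"
    by auto
  hence "submatrix M {i..<n} {i..<n} = mat (n - i) (n - i) (\<lambda>(a, b). M $$ (i + a, i + b))"
    using assms by (intro eq_matI) (auto simp: submatrix_def pick_atLeastLessThan)
  thus ?thesis
    by (simp add: corner_det_def)
qed

lemma (in comm_ring_hom) hom_corner_det:
  assumes "M \<in> carrier_mat n n"
  shows "hom (corner_det n i M) = corner_det n i (map_mat hom M)"
  unfolding corner_det_def hom_det[symmetric]
  by (rule arg_cong[where f = det]) (use assms in \<open>auto intro!: eq_matI\<close>)

lemma corner_minor_alt: "corner_minor n i = corner_det n i (mat n n mpoly_var)"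
  by (simp add: corner_minor_def det_submatrix_corner)

lemma corner_minor_mpolys: "corner_minor n i \<in> mpolys (mat_vars n)"
  unfolding corner_minor_alt corner_det_def by (rule mpolys_det[of "n - i"]) (auto intro!: mpolys_var)

lemma mpoly_eval_corner_minor:
  fixes \<phi> :: "'a::field \<Rightarrow> 'r::comm_ring_1"
  assumes "comm_ring_hom \<phi>" "M \<in> carrier_mat n n"
  shows "mpoly_eval \<phi> (($$) M) (corner_minor n i) = corner_det n i M"
proof -
  interpret \<phi>: comm_ring_hom \<phi> by fact
  interpret comm_ring_hom "mpoly_eval \<phi> (($$) M)"
    by (rule \<phi>.mpoly_eval_hom)
  have "map_mat (mpoly_eval \<phi> (($$) M)) (mat n n mpoly_var) = M"
    using assms(2) by (auto simp: \<phi>.mpoly_eval_var intro!: eq_matI)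
  thus ?thesis
    by (simp add: corner_minor_alt hom_corner_det[of _ n])
qed

section \<open>Expansion of minors of a product over choices of rows\<close>

text \<open>Injective choices of \<open>r\<close> indices below \<open>n\<close>. Prescribing the
  identity outside the first \<open>r\<close> arguments makes each choice a unique function and the
  set finite.\<close>

definition selections :: "nat \<Rightarrow> nat \<Rightarrow> (nat \<Rightarrow> nat) set" where
  "selections r n = {f. (\<forall>a\<in>{0..<r}. f a \<in> {0..<n}) \<and> (\<forall>a. a \<notin> {0..<r} \<longrightarrow> f a = a) \<and> inj_on f {0..<r}}"

lemma finite_selections: "finite (selections r n)"
  by (rule finite_subset[OF _ finite_bounded_functions[of "{0..<n}" "{0..<r}"]])
     (auto simp: selections_def)

text \<open>The Cauchy-Binet expansion before terms with equal image are collected: each row of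
  \<open>P * Q\<close> is a combination of rows of \<open>Q\<close>, the determinant is linear in
  each row, and a choice that is not injective repeats a row.\<close>

lemma det_mult_selections:
  fixes P Q :: "'a::comm_ring_1 mat"
  assumes P: "P \<in> carrier_mat r n" and Q: "Q \<in> carrier_mat n r"
  shows "det (P * Q) =
    (\<Sum>f\<in>selections r n. (\<Prod>a = 0..<r. P $$ (a, f a)) * det (mat r r (\<lambda>(a, b). Q $$ (f a, b))))"
proof -
  let ?F = "{f. (\<forall>a\<in>{0..<r}. f a \<in> {0..<n}) \<and> (\<forall>a. a \<notin> {0..<r} \<longrightarrow> f a = a)}"
  let ?B = "\<lambda>f. mat\<^sub>r r r (\<lambda>a. row Q (f a))"
  have "det (P * Q) = (\<Sum>f\<in>?F. det (mat\<^sub>r r r (\<lambda>a. P $$ (a, f a) \<cdot>\<^sub>v row Q (f a))))"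
    unfolding mat_mul_finsum_alt[OF P Q]
    by (rule det_linear_rows_sum) (use P Q in auto)
  also have "\<dots> = (\<Sum>f\<in>?F. (\<Prod>a = 0..<r. P $$ (a, f a)) * det (?B f))"
    by (intro sum.cong refl det_rows_mul) (use Q in auto)
  also have "\<dots> = (\<Sum>f\<in>selections r n. (\<Prod>a = 0..<r. P $$ (a, f a)) * det (?B f))"
  proof (rule sum.mono_neutral_right)
    show "finite ?F"
      by (rule finite_bounded_functions) auto
    show "\<forall>f\<in>?F - selections r n. (\<Prod>a = 0..<r. P $$ (a, f a)) * det (?B f) = 0"
    proof
      fix f assume f: "f \<in> ?F - selections r n"
      then obtain a b where ab: "a < r" "b < r" "a \<noteq> b" "f a = f b"
        by (auto simp: selections_def inj_on_def)
      have "det (?B f) = 0"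
        by (rule det_identical_rows[of _ r a b]) (use ab Q in auto)
      thus "(\<Prod>a = 0..<r. P $$ (a, f a)) * det (?B f) = 0" by simp
    qed
  qed (auto simp: selections_def)
  also have "\<dots> = (\<Sum>f\<in>selections r n. (\<Prod>a = 0..<r. P $$ (a, f a)) * det (mat r r (\<lambda>(a, b). Q $$ (f a, b))))"
    by (intro sum.cong refl arg_cong2[where f = "(*)"] arg_cong[where f = det] eq_matI)
       (use Q in \<open>auto simp: selections_def\<close>)
  finally show ?thesis .
qed

text \<open>The corner of the product is the bottom rows of \<open>A * mat_diag n d\<close> times
  the right columns of \<open>B\<close>; the diagonal entries then factor out of each term.\<close>

lemma corner_det_mult_diag:
  fixes A B :: "'a::comm_ring_1 mat"
  assumes "A \<in> carrier_mat n n" "B \<in> carrier_mat n n"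
  shows "corner_det n i (A * mat_diag n d * B) =
    (\<Sum>f\<in>selections (n - i) n. (\<Prod>a = 0..<n - i. A $$ (i + a, f a)) * (\<Prod>a = 0..<n - i. d (f a)) *
       det (mat (n - i) (n - i) (\<lambda>(a, b). B $$ (f a, i + b))))"
proof -
  let ?P = "mat (n - i) n (\<lambda>(a, j). A $$ (i + a, j) * d j)" and ?Q = "mat n (n - i) (\<lambda>(j, b). B $$ (j, i + b))"
  have "mat (n - i) (n - i) (\<lambda>(a, b). (A * mat_diag n d * B) $$ (i + a, i + b)) = ?P * ?Q"
    using assms by (intro eq_matI) (auto simp: mat_diag_mult_right[of _ n] scalar_prod_def)
  hence "corner_det n i (A * mat_diag n d * B) = det (?P * ?Q)"
    by (simp add: corner_det_def)
  also have "\<dots> = (\<Sum>f\<in>selections (n - i) n. (\<Prod>a = 0..<n - i. ?P $$ (a, f a)) *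
      det (mat (n - i) (n - i) (\<lambda>(a, b). ?Q $$ (f a, b))))"
    by (rule det_mult_selections) auto
  also have "\<dots> = (\<Sum>f\<in>selections (n - i) n. (\<Prod>a = 0..<n - i. A $$ (i + a, f a)) * (\<Prod>a = 0..<n - i. d (f a)) *
       det (mat (n - i) (n - i) (\<lambda>(a, b). B $$ (f a, i + b))))"
    by (intro sum.cong refl arg_cong2[where f = "(*)"] arg_cong[where f = det] eq_matI)
       (auto simp: selections_def prod.distrib[symmetric] intro!: prod.cong)
  finally show ?thesis .
qed

text \<open>Exchange argument: outside their intersection, the tail consists of values at most
  \<open>\<alpha> i\<close> and \<open>I\<close> of values at least \<open>\<alpha> i\<close>, in
  equal number.\<close>

lemma sum_tail_le:
  fixes \<alpha> :: "nat \<Rightarrow> int"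
  assumes antimono: "\<And>i j. i \<le> j \<Longrightarrow> j < n \<Longrightarrow> \<alpha> j \<le> \<alpha> i"
    and I: "I \<subseteq> {..<n}" "card I = n - i"
  shows "(\<Sum>j = i..<n. \<alpha> j) \<le> (\<Sum>j\<in>I. \<alpha> j)"
proof (cases "i < n")
  case False
  hence "I = {}"
    using I finite_subset[OF I(1)] by auto
  thus ?thesis using False by simp
next
  case True
  let ?J = "{i..<n}"
  have fin: "finite I"
    using I finite_subset by blast
  have "card (I - ?J) = card (?J - I)"
    using card_Diff_subset_Int[of I ?J] card_Diff_subset_Int[of ?J I] I fin by (simp add: Int_commute)
  have "(\<Sum>j\<in>?J - I. \<alpha> j) \<le> of_nat (card (?J - I)) * \<alpha> i"
    by (rule sum_bounded_above) (auto intro: antimono)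
  also have "\<dots> = of_nat (card (I - ?J)) * \<alpha> i"
    by (simp add: \<open>card (I - ?J) = card (?J - I)\<close>)
  also have "\<dots> \<le> (\<Sum>j\<in>I - ?J. \<alpha> j)"
    by (rule sum_bounded_below) (use True I in \<open>auto intro!: antimono\<close>)
  finally have "(\<Sum>j\<in>?J - I. \<alpha> j) + (\<Sum>j\<in>I \<inter> ?J. \<alpha> j) \<le> (\<Sum>j\<in>I - ?J. \<alpha> j) + (\<Sum>j\<in>I \<inter> ?J. \<alpha> j)"
    by simp
  moreover have "(\<Sum>j\<in>?J. \<alpha> j) = (\<Sum>j\<in>?J - I. \<alpha> j) + (\<Sum>j\<in>I \<inter> ?J. \<alpha> j)"
    by (subst sum.union_disjoint[symmetric]) (auto simp: fin intro: sum.cong)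
  moreover have "(\<Sum>j\<in>I. \<alpha> j) = (\<Sum>j\<in>I - ?J. \<alpha> j) + (\<Sum>j\<in>I \<inter> ?J. \<alpha> j)"
    by (subst sum.union_disjoint[symmetric]) (auto simp: fin intro: sum.cong)
  ultimately show ?thesis by simp
qed

lemma selections_weight_ge:
  fixes \<alpha> :: "nat \<Rightarrow> int"
  assumes "\<And>i j. i \<le> j \<Longrightarrow> j < n \<Longrightarrow> \<alpha> j \<le> \<alpha> i" "f \<in> selections (n - i) n"
  shows "(\<Sum>j = i..<n. \<alpha> j) \<le> (\<Sum>a = 0..<n - i. \<alpha> (f a))"
proof -
  have "(\<Sum>a = 0..<n - i. \<alpha> (f a)) = (\<Sum>j\<in>f ` {0..<n - i}. \<alpha> j)"
    using assms(2) by (subst sum.reindex) (auto simp: selections_def)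
  thus ?thesis
    using sum_tail_le[of n \<alpha> "f ` {0..<n - i}" i, OF assms(1)] assms(2)
    by (auto simp: selections_def card_image)
qed

section \<open>The lowest coefficient of a corner minor\<close>

text \<open>The part of the expansion of \<open>corner_det_mult_diag\<close> in which the chosen
  exponents have the minimal sum, with the powers of \<open>t\<close> removed. It is applied to the
  constant terms of matrices over \<open>k[[t]]\<close>.\<close>

definition corner_lead :: "nat \<Rightarrow> nat \<Rightarrow> (nat \<Rightarrow> int) \<Rightarrow> 'a::comm_ring_1 mat \<Rightarrow> 'a mat \<Rightarrow> 'a" where
  "corner_lead n i \<alpha> A B =
     (\<Sum>f\<in>{f \<in> selections (n - i) n. (\<Sum>a = 0..<n - i. \<alpha> (f a)) = (\<Sum>j = i..<n. \<alpha> j)}.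
        (\<Prod>a = 0..<n - i. A $$ (i + a, f a)) * det (mat (n - i) (n - i) (\<lambda>(a, b). B $$ (f a, i + b))))"

lemma prod_fls_X_intpow: "finite I \<Longrightarrow> (\<Prod>a\<in>I. fls_X_intpow (\<alpha> a) :: 'a::comm_ring_1 fls) = fls_X_intpow (\<Sum>a\<in>I. \<alpha> a)"
  by (induction I rule: finite_induct) (auto simp: fls_X_intpow_times_fls_X_intpow)

lemma fls_nth_fls_X_intpow_times:
  "fls_nth (fls_X_intpow e * fps_to_fls w :: 'a::comm_ring_1 fls) k = (if k < e then 0 else fps_nth w (nat (k - e)))"
  by (auto simp: fls_X_intpow_times_conv_shift)

lemma fps_const_term_hom: "comm_ring_hom (\<lambda>w :: 'a::comm_ring_1 fps. fps_nth w 0)"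
  by unfold_locales auto

text \<open>Each selection \<open>f\<close> contributes \<open>t^(e f)\<close> times a power series
  \<open>w f\<close>, and \<open>e f\<close> is at least the tail sum.\<close>

lemma corner_det_coeffs:
  fixes A B :: "'a::field fps mat"
  assumes carrier: "A \<in> carrier_mat n n" "B \<in> carrier_mat n n"
    and antimono: "\<And>i j. i \<le> j \<Longrightarrow> j < n \<Longrightarrow> \<alpha> j \<le> \<alpha> i"
  defines "M \<equiv> map_mat fps_to_fls A * mat_diag n (\<lambda>i. fls_X_intpow (\<alpha> i)) * map_mat fps_to_fls B"
  shows "k < (\<Sum>j = i..<n. \<alpha> j) \<Longrightarrow> fls_nth (corner_det n i M) k = 0"
    and "fls_nth (corner_det n i M) (\<Sum>j = i..<n. \<alpha> j) =
      corner_lead n i \<alpha> (map_mat (\<lambda>w. fps_nth w 0) A) (map_mat (\<lambda>w. fps_nth w 0) B)"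
proof -
  interpret comm_ring_hom "fps_to_fls :: 'a fps \<Rightarrow> 'a fls"
    by (rule fps_to_fls_hom)
  interpret c: comm_ring_hom "\<lambda>w :: 'a fps. fps_nth w 0"
    by (rule fps_const_term_hom)
  let ?s = "\<Sum>j = i..<n. \<alpha> j"
  define e where "e f = (\<Sum>a = 0..<n - i. \<alpha> (f a))" for f
  define w where "w f = (\<Prod>a = 0..<n - i. A $$ (i + a, f a)) * det (mat (n - i) (n - i) (\<lambda>(a, b). B $$ (f a, i + b)))" for f
  have "corner_det n i M = (\<Sum>f\<in>selections (n - i) n. fls_X_intpow (e f) * fps_to_fls (w f))"
    unfolding M_def using carrier
  proof (subst corner_det_mult_diag, goal_cases)
    case 3
    show ?case
    proof (intro sum.cong refl, goal_cases)
      case (1 f)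
      have "mat (n - i) (n - i) (\<lambda>(a, b). map_mat fps_to_fls B $$ (f a, i + b)) =
          map_mat fps_to_fls (mat (n - i) (n - i) (\<lambda>(a, b). B $$ (f a, i + b)))"
        using 1 carrier by (intro eq_matI) (auto simp: selections_def)
      moreover have "(\<Prod>a = 0..<n - i. map_mat fps_to_fls A $$ (i + a, f a)) =
          fps_to_fls (\<Prod>a = 0..<n - i. A $$ (i + a, f a))"
        unfolding hom_prod using 1 carrier by (intro prod.cong) (auto simp: selections_def)
      ultimately show ?case
        by (simp add: prod_fls_X_intpow e_def w_def hom_mult mult_ac)
    qed
  qed auto
  hence nth: "fls_nth (corner_det n i M) k =
      (\<Sum>f\<in>selections (n - i) n. if k < e f then 0 else fps_nth (w f) (nat (k - e f)))" for k
    by (simp add: fls_nth_sum fls_nth_fls_X_intpow_times)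
  have ge: "?s \<le> e f" if "f \<in> selections (n - i) n" for f
    unfolding e_def by (rule selections_weight_ge[OF antimono that])
  show "fls_nth (corner_det n i M) k = 0" if "k < ?s"
    unfolding nth by (rule sum.neutral) (use ge that in force)
  \<comment> \<open>Selections of larger weight start in a higher degree; those of minimal weight
    contribute the constant term of \<open>w f\<close>.\<close>
  have "fls_nth (corner_det n i M) ?s = (\<Sum>f\<in>selections (n - i) n. if e f = ?s then fps_nth (w f) 0 else 0)"
    unfolding nth by (rule sum.cong) (use ge in force)+
  also have "\<dots> = (\<Sum>f\<in>{f \<in> selections (n - i) n. e f = ?s}. fps_nth (w f) 0)"
    using finite_selections by (simp add: sum.inter_filter)
  also have "\<dots> = corner_lead n i \<alpha> (map_mat (\<lambda>w. fps_nth w 0) A) (map_mat (\<lambda>w. fps_nth w 0) B)"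
    unfolding corner_lead_def e_def
  proof (rule sum.cong, goal_cases)
    case (2 f)
    have "mat (n - i) (n - i) (\<lambda>(a, b). map_mat (\<lambda>w. fps_nth w 0) B $$ (f a, i + b)) =
        map_mat (\<lambda>w. fps_nth w 0) (mat (n - i) (n - i) (\<lambda>(a, b). B $$ (f a, i + b)))"
      using 2 carrier by (intro eq_matI) (auto simp: selections_def)
    moreover have "(\<Prod>a = 0..<n - i. map_mat (\<lambda>w. fps_nth w 0) A $$ (i + a, f a)) =
        fps_nth (\<Prod>a = 0..<n - i. A $$ (i + a, f a)) 0"
      unfolding c.hom_prod using 2 carrier by (intro prod.cong) (auto simp: selections_def)
    ultimately show ?case
      unfolding w_def c.hom_mult by simp
  qed simp
  finally show "fls_nth (corner_det n i M) ?s = \<dots>" .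
qed

lemma corner_lead_one: "corner_lead n i \<alpha> (1\<^sub>m n) (1\<^sub>m n) = 1"
proof (cases "i \<le> n")
  case True
  \<comment> \<open>The selection of the last \<open>n - i\<close> indices in order is the only one
    with a nonzero term at the identity matrix, and its weight is the tail sum itself.\<close>
  define f\<^sub>0 where "f\<^sub>0 a = (if a < n - i then i + a else a)" for a
  have f\<^sub>0: "f\<^sub>0 \<in> selections (n - i) n"
    using True by (auto simp: selections_def f\<^sub>0_def inj_on_def)
  have weight: "(\<Sum>a = 0..<n - i. \<alpha> (f\<^sub>0 a)) = (\<Sum>j = i..<n. \<alpha> j)"
    by (rule sum.reindex_bij_witness[of _ "\<lambda>j. j - i" "\<lambda>a. i + a"]) (auto simp: f\<^sub>0_def)
  let ?S = "{f \<in> selections (n - i) n. (\<Sum>a = 0..<n - i. \<alpha> (f a)) = (\<Sum>j = i..<n. \<alpha> j)}"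
  let ?t = "\<lambda>f. (\<Prod>a = 0..<n - i. 1\<^sub>m n $$ (i + a, f a)) * det (mat (n - i) (n - i) (\<lambda>(a, b). 1\<^sub>m n $$ (f a, i + b))) :: 'a"
  have "?t f = 0" if f: "f \<in> ?S - {f\<^sub>0}" for f
  proof -
    obtain a where "f a \<noteq> f\<^sub>0 a"
      using f by (auto simp: fun_eq_iff)
    hence "a < n - i" "f a \<noteq> i + a"
      using that by (auto simp: selections_def f\<^sub>0_def split: if_splits)
    moreover from this have "f a < n"
      using that by (auto simp: selections_def)
    ultimately have "1\<^sub>m n $$ (i + a, f a) = (0 :: 'a)"
      by auto
    hence "(\<Prod>a = 0..<n - i. 1\<^sub>m n $$ (i + a, f a)) = (0 :: 'a)"
      using \<open>a < n - i\<close> by (intro prod_zero) auto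
    thus ?thesis by simp
  qed
  hence "corner_lead n i \<alpha> (1\<^sub>m n) (1\<^sub>m n) = (\<Sum>f\<in>{f\<^sub>0}. ?t f)"
    unfolding corner_lead_def using f\<^sub>0 weight finite_selections
    by (intro sum.mono_neutral_right) auto
  also have "\<dots> = 1"
  proof -
    have "mat (n - i) (n - i) (\<lambda>(a, b). 1\<^sub>m n $$ (f\<^sub>0 a, i + b)) = (1\<^sub>m (n - i) :: 'a mat)"
      by (intro eq_matI) (auto simp: f\<^sub>0_def)
    thus ?thesis
      by (auto simp: f\<^sub>0_def intro!: prod.neutral)
  qed
  finally show ?thesis .
next
  case False
  hence "selections (n - i) n = {\<lambda>a. a}"
    by (auto simp: selections_def)
  thus ?thesis
    using False by (simp add: corner_lead_def)
qed

text \<open>Every term contains \<open>n - i\<close> entries of \<open>A\<close>. This passes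
  between the inverse of \<open>g\<close> and its adjugate.\<close>

lemma corner_lead_smult:
  assumes "A \<in> carrier_mat n n"
  shows "corner_lead n i \<alpha> (c \<cdot>\<^sub>m A) B = c ^ (n - i) * corner_lead n i \<alpha> A B"
proof -
  have "(\<Prod>a = 0..<n - i. (c \<cdot>\<^sub>m A) $$ (i + a, f a)) = c ^ (n - i) * (\<Prod>a = 0..<n - i. A $$ (i + a, f a))"
    if "f \<in> selections (n - i) n" for f
  proof -
    have "(\<Prod>a = 0..<n - i. (c \<cdot>\<^sub>m A) $$ (i + a, f a)) = (\<Prod>a = 0..<n - i. c * A $$ (i + a, f a))"
      using that assms by (intro prod.cong) (auto simp: selections_def)
    thus ?thesis by (simp add: prod.distrib)
  qed
  thus ?thesis
    unfolding corner_lead_def sum_distrib_left by (intro sum.cong) auto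
qed

lemma polyfun2_corner_lead:
  assumes "A \<in> carrier_mat n n" "B \<in> carrier_mat n n"
  shows "polyfun2 n (\<lambda>g h. corner_lead n i \<alpha> (adj_mat g * A) (B * h))"
proof -
  have entry1: "polyfun2 n (\<lambda>g h. (adj_mat g * A) $$ (a, b))" if "a < n" "b < n" for a b
  proof (rule polyfun2_cong)
    show "polyfun2 n (\<lambda>g h. \<Sum>j = 0..<n. adj_mat g $$ (a, j) * A $$ (j, b))"
      using that by (intro polyfun2_sum polyfun2_mult polyfun2_const polyfun2_adj_mat) auto
  next
    fix g :: "'a mat" assume "g \<in> carrier_mat n n"
    thus "(\<Sum>j = 0..<n. adj_mat g $$ (a, j) * A $$ (j, b)) = (adj_mat g * A) $$ (a, b)"
      using adj_mat(1)[of g n] that assms by (simp add: scalar_prod_def)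
  qed
  have entry2: "polyfun2 n (\<lambda>g h. (B * h) $$ (a, b))" if "a < n" "b < n" for a b
  proof (rule polyfun2_cong)
    show "polyfun2 n (\<lambda>g h. \<Sum>j = 0..<n. B $$ (a, j) * h $$ (j, b))"
      using that by (intro polyfun2_sum polyfun2_mult polyfun2_const polyfun2_entry2) auto
  next
    fix h :: "'a mat" assume "h \<in> carrier_mat n n"
    thus "(\<Sum>j = 0..<n. B $$ (a, j) * h $$ (j, b)) = (B * h) $$ (a, b)"
      using that assms by (simp add: scalar_prod_def)
  qed
  show ?thesis
    unfolding corner_lead_def
    by (intro polyfun2_sum polyfun2_mult polyfun2_prod polyfun2_det entry1 entry2)
       (auto simp: selections_def)
qed

section \<open>Fractional powers of \<open>t\<close>\<close>

text \<open>\<open>puiseux_root m f\<close> is \<open>f(t\<^sup>1\<^sup>/\<^sup>(\<^sup>m\<^sup>+\<^sup>1\<^sup>))\<close>; the shift of \<open>m\<close> keeps the denominator positive.\<close>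

definition puiseux_root :: "nat \<Rightarrow> 'a::zero fls \<Rightarrow> 'a puiseux" where
  "puiseux_root m f = abs_puiseux (Suc m, f)"

lemma puiseux_rel_self: "puiseux_rel (Suc m, f) (Suc m, f)"
  by (simp add: puiseux_rel_def)

lemma abs_puiseux_eqI: "puiseux_rel x y \<Longrightarrow> abs_puiseux x = abs_puiseux y"
  by (rule Quotient3_rel_abs[OF Quotient3_puiseux])

lemma puiseux_root_hom: "comm_ring_hom (puiseux_root m :: 'a::field fls \<Rightarrow> _)"
proof
  fix f g :: "'a fls"
  show "puiseux_root m (f + g) = puiseux_root m f + puiseux_root m g"
    unfolding puiseux_root_def plus_puiseux.abs_eq[OF puiseux_rel_self puiseux_rel_self]
    by (rule abs_puiseux_eqI) (simp add: puiseux_rel_def fls_compose_power_compose_power)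
  show "puiseux_root m (f * g) = puiseux_root m f * puiseux_root m g"
    unfolding puiseux_root_def times_puiseux.abs_eq[OF puiseux_rel_self puiseux_rel_self]
    by (rule abs_puiseux_eqI) (simp add: puiseux_rel_def fls_compose_power_compose_power)
  show "puiseux_root m (1 :: 'a fls) = 1"
    unfolding puiseux_root_def one_puiseux_def
    by (rule abs_puiseux_eqI) (simp add: puiseux_rel_def)
  show "puiseux_root m (0 :: 'a fls) = 0"
    unfolding puiseux_root_def zero_puiseux_def
    by (rule abs_puiseux_eqI) (simp add: puiseux_rel_def)
qed

lemma puiseux_val_root: "puiseux_val (puiseux_root m f) = of_int (fls_subdegree f) / of_nat (Suc m)"
  unfolding puiseux_root_def puiseux_val.abs_eq[OF puiseux_rel_self] by simp

lemma puiseux_root_const: "puiseux_root m (fls_const c) = puiseux_const c"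
  unfolding puiseux_root_def puiseux_const.abs_eq
  by (rule abs_puiseux_eqI) (simp add: puiseux_rel_def)

text \<open>Replacing \<open>t\<close> by a power is undone by enlarging the denominator to
  \<open>Suc m * Suc d\<close>; subtracting 1 compensates the shift built into
  \<open>puiseux_root\<close>.\<close>

lemma puiseux_root_refine:
  "puiseux_root m f = puiseux_root (Suc m * Suc d - 1) (fls_compose_power f (Suc d))"
  unfolding puiseux_root_def
  by (rule abs_puiseux_eqI) (simp add: puiseux_rel_def fls_compose_power_compose_power mult.commute)

lemma puiseux_root_exists: "\<exists>m f. z = puiseux_root m f"
proof -
  obtain m f where rep: "rep_puiseux z = (m, f)"
    by fastforce
  \<comment> \<open>Representatives lie in the domain of the partial equivalence, which contains
    only positive denominators.\<close>
  have "puiseux_rel (m, f) (m, f)"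
    using Quotient3_rep_reflp[OF Quotient3_puiseux, of z] by (simp add: rep)
  then obtain m' where "m = Suc m'"
    by (cases m) (auto simp: puiseux_rel_def)
  hence "z = puiseux_root m' f"
    using Quotient3_abs_rep[OF Quotient3_puiseux, of z] by (simp add: puiseux_root_def rep)
  thus ?thesis by blast
qed

lemma puiseux_common_root:
  assumes "finite Z"
  shows "\<exists>m. Z \<subseteq> range (puiseux_root m)"
  using assms
proof (induction Z rule: finite_induct)
  case (insert z Z)
  then obtain m where m: "Z \<subseteq> range (puiseux_root m)" by blast
  obtain d f where z: "z = puiseux_root d f"
    using puiseux_root_exists by blast
  have "puiseux_root m f' \<in> range (puiseux_root (Suc m * Suc d - 1))" for f' :: "'a fls"
    by (subst puiseux_root_refine[of m f' d]) simp
  moreover have "z \<in> range (puiseux_root (Suc m * Suc d - 1))"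
    unfolding z by (subst puiseux_root_refine[of d f m]) (simp only: mult.commute rangeI)
  ultimately show ?case
    using m by (intro exI[of _ "Suc m * Suc d - 1"]) blast
qed simp

lemma puiseux_const_hom: "comm_ring_hom (puiseux_const :: 'a::field \<Rightarrow> _)"
proof -
  interpret comm_ring_hom "puiseux_root 0 :: 'a fls \<Rightarrow> _"
    by (rule puiseux_root_hom)
  show ?thesis
    unfolding puiseux_root_const[of 0, symmetric]
    by unfold_locales (simp_all add: hom_add hom_mult flip: fls_plus_const fls_const_mult_const)
qed

lemma fls_const_hom: "comm_ring_hom (fls_const :: 'a::comm_ring_1 \<Rightarrow> _)"
  by unfold_locales (simp_all add: fls_plus_const)

lemma fps_const_hom: "comm_ring_hom (fps_const :: 'a::comm_ring_1 \<Rightarrow> _)"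
  by unfold_locales simp_all

text \<open>
  The homomorphisms \<open>f(t) \<mapsto> f(t\<^sup>c)\<close> for rational \<open>c > 0\<close>.
\<close>

locale fls_rescaling =
  fixes \<iota> :: "'a::field fls \<Rightarrow> 'a puiseux" and c :: rat
  assumes hom: "comm_ring_hom \<iota>"
    and const: "\<And>a. \<iota> (fls_const a) = puiseux_const a"
    and val: "\<And>f. puiseux_val (\<iota> f) = c * of_int (fls_subdegree f)"
begin

sublocale comm_ring_hom \<iota>
  by (rule hom)

lemma divide: "\<iota> (f / g) = \<iota> f / \<iota> g" if "g \<noteq> 0"
proof -
  have "\<iota> (f / g) * \<iota> g = \<iota> f" "\<iota> g * \<iota> (inverse g) = 1"
    using that by (simp_all flip: hom_mult)
  thus ?thesis
    by (metis mult_zero_left nonzero_eq_divide_eq zero_neq_one)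
qed

lemma eq_0_iff: "\<iota> f = 0 \<longleftrightarrow> f = 0"
proof
  assume "\<iota> f = 0"
  hence "\<iota> (f * inverse f) = 0"
    by (simp only: hom_mult) simp
  thus "f = 0"
    by (cases "f = 0") simp_all
qed simp

lemma map_GL_iff: "map_mat \<iota> x \<in> GL n \<longleftrightarrow> x \<in> GL n"
  by (auto simp: GL_field_iff eq_0_iff)

lemma mpoly_eval_rescale: "mpoly_eval puiseux_const (\<lambda>v. \<iota> (a v)) p = \<iota> (mpoly_eval fls_const a p)"
  by (simp add: hom_mpoly_eval const)

text \<open>The equations of \<open>Y\<close> have coefficients in \<open>k\<close>, which
  \<open>\<iota>\<close> respects, and \<open>\<iota>\<close> is injective; so they hold at
  \<open>x\<close> exactly when they hold at its image.\<close>

lemma points_over_iff: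
  "map_mat \<iota> x \<in> points_over puiseux_const n Y \<longleftrightarrow> x \<in> points_over fls_const n Y"
proof -
  have "mpoly_eval puiseux_const (($$) (map_mat \<iota> x)) p = 0 \<longleftrightarrow> mpoly_eval fls_const (($$) x) p = 0"
    if "x \<in> GL n" "p \<in> vanishing_ideal n Y" for p
  proof -
    have "mpoly_eval puiseux_const (($$) (map_mat \<iota> x)) p = mpoly_eval puiseux_const (\<lambda>v. \<iota> (x $$ v)) p"
      using that by (intro mpoly_eval_cong[of p "mat_vars n"]) (auto simp: vanishing_ideal_def dest: GL_carrier)
    thus ?thesis
      by (simp add: mpoly_eval_rescale eq_0_iff)
  qed
  thus ?thesis
    by (auto simp: points_over_def map_GL_iff)
qed

end

lemma fls_rescaling_root: "fls_rescaling (puiseux_root m) (1 / of_nat (Suc m))"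
  by (intro fls_rescaling.intro puiseux_root_hom puiseux_root_const) (simp add: puiseux_val_root)

lemma fls_compose_power_hom:
  "d > 0 \<Longrightarrow> comm_ring_hom (\<lambda>f :: 'a::idom fls. fls_compose_power f d)"
  by unfold_locales simp_all

text \<open>Composing \<open>t \<mapsto> t^d\<close> with a root of \<open>t\<close> realizes every
  positive rational factor.\<close>

lemma fls_rescaling_root_power:
  assumes "d > 0"
  shows "fls_rescaling (\<lambda>f. puiseux_root m (fls_compose_power f d)) (of_nat d / of_nat (Suc m))"
proof -
  interpret r: comm_ring_hom "puiseux_root m :: 'a fls \<Rightarrow> _"
    by (rule puiseux_root_hom)
  interpret p: comm_ring_hom "\<lambda>f :: 'a fls. fls_compose_power f d"
    by (rule fls_compose_power_hom[OF assms])
  show ?thesis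
    using assms
    by unfold_locales
       (simp_all add: r.hom_add r.hom_mult puiseux_root_const puiseux_val_root fls_subdegree_compose_power)
qed

section \<open>Computation of the tropicalization\<close>

text \<open>Two representations of a fraction agree after cross multiplication, and evaluation
  preserves this identity.\<close>

lemma ratfun_value_unique:
  assumes "comm_ring_hom \<phi>" "ratfun_value \<phi> n f x y" "ratfun_value \<phi> n f x y'"
  shows "y = y'"
proof -
  interpret \<phi>: comm_ring_hom \<phi> by fact
  interpret comm_ring_hom "mpoly_eval \<phi> (($$) x)"
    by (rule \<phi>.mpoly_eval_hom)
  obtain p q p' q' where pq: "f = Fract p q" "mpoly_eval \<phi> (($$) x) q \<noteq> 0"
      "y = mpoly_eval \<phi> (($$) x) p / mpoly_eval \<phi> (($$) x) q"
    and pq': "f = Fract p' q'" "mpoly_eval \<phi> (($$) x) q' \<noteq> 0"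
      "y' = mpoly_eval \<phi> (($$) x) p' / mpoly_eval \<phi> (($$) x) q'"
    using assms(2,3) unfolding ratfun_value_def by blast
  have "q \<noteq> 0" "q' \<noteq> 0"
    using pq(2) pq'(2) by auto
  hence "p * q' = p' * q"
    using pq(1) pq'(1) by (simp add: eq_fract(1))
  hence "mpoly_eval \<phi> (($$) x) p * mpoly_eval \<phi> (($$) x) q' = mpoly_eval \<phi> (($$) x) p' * mpoly_eval \<phi> (($$) x) q"
    by (simp flip: hom_mult)
  thus ?thesis
    using pq pq' by (simp add: frac_eq_eq)
qed

text \<open>One nonempty open set with constant valuation determines the value: any other such set
  meets it, and the value of \<open>f\<close> at a common point is unique.\<close>

lemma trop_val_eqI:
  fixes \<gamma> :: "'a::alg_closed_field puiseux mat"
  assumes U: "zopen_GL2 n U" "U \<noteq> {}"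
    and eq: "\<And>g h. (g, h) \<in> U \<Longrightarrow> \<exists>y. ratfun_value puiseux_const n f
      (map_mat puiseux_const (the (mat_inverse g)) * \<gamma> * map_mat puiseux_const h) y \<and> y \<noteq> 0 \<and> puiseux_val y = a"
  shows "trop_val n \<gamma> f = a"
  unfolding trop_val_def
proof (rule the_equality)
  fix a'
  assume "\<exists>V. zopen_GL2 n V \<and> V \<noteq> {} \<and> (\<forall>(g, h)\<in>V. \<exists>y. ratfun_value puiseux_const n f
    (map_mat puiseux_const (the (mat_inverse g)) * \<gamma> * map_mat puiseux_const h) y \<and> y \<noteq> 0 \<and> puiseux_val y = a')"
  then obtain V where V: "zopen_GL2 n V" "V \<noteq> {}" "\<And>g h. (g, h) \<in> V \<Longrightarrow> \<exists>y. ratfun_value puiseux_const n f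
    (map_mat puiseux_const (the (mat_inverse g)) * \<gamma> * map_mat puiseux_const h) y \<and> y \<noteq> 0 \<and> puiseux_val y = a'"
    by blast
  obtain g h where "(g, h) \<in> U" "(g, h) \<in> V"
    using zopen_GL2_meet[OF U V(1,2)] by auto
  thus "a' = a"
    using eq[of g h] V(3)[of g h] ratfun_value_unique[OF puiseux_const_hom] by metis
qed (use assms in blast)

lemma const_term_const: "map_mat (\<lambda>w. fps_nth w 0) (map_mat fps_const A) = A"
  by (intro eq_matI) auto

lemma trop_val_spherical_fun:
  fixes x :: "'a::alg_closed_field fls mat" and \<alpha> :: "int vec"
  assumes "fls_rescaling \<iota> c" and x: "x \<in> carrier_mat n n" "is_invariant_factors n x \<alpha>" and i: "i < n"
  shows "trop_val n (map_mat \<iota> x) (spherical_fun n i) = c * of_int (\<alpha> $ i)"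
proof -
  interpret fls_rescaling \<iota> c by fact
  interpret F: comm_ring_hom "fps_to_fls :: 'a fps \<Rightarrow> 'a fls"
    by (rule fps_to_fls_hom)
  interpret C: comm_ring_hom "\<lambda>w :: 'a fps. fps_nth w 0"
    by (rule fps_const_term_hom)
  let ?c = "map_mat (\<lambda>w :: 'a fps. fps_nth w 0)"
  define D where "D = (mat_diag n (\<lambda>i. fls_X_intpow (\<alpha> $ i)) :: 'a fls mat)"
  obtain g\<^sub>0 h\<^sub>0 where gh\<^sub>0: "g\<^sub>0 \<in> GL n" "h\<^sub>0 \<in> GL n" "map_mat fps_to_fls g\<^sub>0 * x * map_mat fps_to_fls h\<^sub>0 = D"
    and antimono: "\<And>i j. i \<le> j \<Longrightarrow> j < n \<Longrightarrow> \<alpha> $ j \<le> \<alpha> $ i"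
    using x(2) by (auto simp: is_invariant_factors_def D_def)
  obtain g\<^sub>1 where g\<^sub>1: "g\<^sub>1 \<in> GL n" "g\<^sub>0 * g\<^sub>1 = 1\<^sub>m n" "g\<^sub>1 * g\<^sub>0 = 1\<^sub>m n"
    using GL_obtain_inverse[OF gh\<^sub>0(1)] .
  obtain h\<^sub>1 where h\<^sub>1: "h\<^sub>1 \<in> GL n" "h\<^sub>0 * h\<^sub>1 = 1\<^sub>m n" "h\<^sub>1 * h\<^sub>0 = 1\<^sub>m n"
    using GL_obtain_inverse[OF gh\<^sub>0(2)] .
  note carrier = gh\<^sub>0(1,2)[THEN GL_carrier] GL_carrier[OF g\<^sub>1(1)] GL_carrier[OF h\<^sub>1(1)] x(1)
  have x_eq: "x = map_mat fps_to_fls g\<^sub>1 * D * map_mat fps_to_fls h\<^sub>1"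
  proof -
    have "map_mat fps_to_fls g\<^sub>1 * D * map_mat fps_to_fls h\<^sub>1 =
        (map_mat fps_to_fls g\<^sub>1 * map_mat fps_to_fls g\<^sub>0) * x * (map_mat fps_to_fls h\<^sub>0 * map_mat fps_to_fls h\<^sub>1)"
      unfolding gh\<^sub>0(3)[symmetric] using carrier by (simp add: assoc_mult_mat[of _ n n _ n _ n])
    also have "\<dots> = x"
      using carrier by (simp add: g\<^sub>1(3) h\<^sub>1(2) F.mat_hom_one flip: F.mat_hom_mult[of _ n n _ n])
    finally show ?thesis ..
  qed
  \<comment> \<open>The expected lowest coefficient of the \<open>j\<close>-th corner minor of the
    translate of \<open>x\<close>. The first argument will be both the adjugate and the inverse of
    the group element.\<close>
  define lead where "lead j g h = corner_lead n j (\<lambda>i. \<alpha> $ i) (g * ?c g\<^sub>1) (?c h\<^sub>1 * h)" for j and g h :: "'a mat"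
  have lead_smult: "lead j (a \<cdot>\<^sub>m g) h = a ^ (n - j) * lead j g h" if "g \<in> carrier_mat n n" for j a g h
    unfolding lead_def using that carrier
    by (subst mult_smult_assoc_mat[of _ n n _ n]) (auto intro!: corner_lead_smult)
  \<comment> \<open>Both minors in the fraction \<open>spherical_fun n i\<close> must attain their
    expected order; the adjugate keeps the condition polynomial in \<open>(g, h)\<close>.\<close>
  define U where "U = {(g, h) \<in> GL n \<times> GL n. lead i (adj_mat g) h * lead (Suc i) (adj_mat g) h \<noteq> 0}"
  have "zopen_GL2 n U"
    unfolding U_def lead_def using carrier
    by (intro zopen_GL2_nonzero polyfun2_mult polyfun2_corner_lead) auto
  moreover have "U \<noteq> {}"
  proof -
    have GL: "?c g\<^sub>1 \<in> GL n" "?c h\<^sub>0 \<in> GL n"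
      using C.hom_GL g\<^sub>1(1) gh\<^sub>0(2) by blast+
    \<comment> \<open>At this pair the outer factors cancel against the constant terms of
      \<open>g\<^sub>1\<close> and \<open>h\<^sub>1\<close>: they become a scalar matrix, with
      scalar the determinant, and the identity.\<close>
    have "?c h\<^sub>1 * ?c h\<^sub>0 = 1\<^sub>m n"
      using carrier by (simp add: h\<^sub>1(3) C.mat_hom_one flip: C.mat_hom_mult[of _ n n _ n])
    hence "lead j (adj_mat (?c g\<^sub>1)) (?c h\<^sub>0) = det (?c g\<^sub>1) ^ (n - j)" for j
      using adj_mat(3)[OF GL_carrier[OF GL(1)]] by (simp add: lead_def corner_lead_smult corner_lead_one)
    hence "(?c g\<^sub>1, ?c h\<^sub>0) \<in> U"
      using GL by (auto simp: U_def GL_field_iff)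
    thus ?thesis by blast
  qed
  ultimately show ?thesis
  proof (rule trop_val_eqI)
    fix g h assume gh: "(g, h) \<in> U"
    hence GL: "g \<in> GL n" "h \<in> GL n"
      by (auto simp: U_def)
    define A where "A = the (mat_inverse g)"
    have A: "A \<in> carrier_mat n n" and h: "h \<in> carrier_mat n n"
      using GL the_mat_inverse(1)[OF GL(1)] by (auto simp: A_def dest: GL_carrier)
    have lead_nz: "lead i A h \<noteq> 0" "lead (Suc i) A h \<noteq> 0"
      using gh A unfolding U_def mat_inverse_adj_mat[OF GL(1), folded A_def]
      by (auto simp: mat_inverse_adj_mat[OF GL(1), folded A_def] lead_smult)
    \<comment> \<open>The constant matrices are absorbed into the integral factors, so the translate
      of \<open>x\<close> is again diagonal between matrices over \<open>k[[t]]\<close>.\<close>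
    define P where "P = map_mat fps_const A * g\<^sub>1"
    define Q where "Q = h\<^sub>1 * map_mat fps_const h"
    define M where "M = map_mat fps_to_fls P * D * map_mat fps_to_fls Q"
    have PQ: "P \<in> carrier_mat n n" "Q \<in> carrier_mat n n" "M \<in> carrier_mat n n"
      using carrier A h by (auto simp: P_def Q_def M_def D_def)
    have "?c P = A * ?c g\<^sub>1" "?c Q = ?c h\<^sub>1 * h"
      unfolding P_def Q_def using carrier A h
      by (simp_all add: C.mat_hom_mult[of _ n n _ n] const_term_const)
    hence lead: "corner_lead n j (\<lambda>i. \<alpha> $ i) (?c P) (?c Q) = lead j A h" for j
      by (simp add: lead_def)
    have corner: "corner_det n j M \<noteq> 0 \<and> fls_subdegree (corner_det n j M) = (\<Sum>l = j..<n. \<alpha> $ l)"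
      if "lead j A h \<noteq> 0" for j
    proof -
      note coeffs = corner_det_coeffs[where \<alpha> = "\<lambda>i. \<alpha> $ i", OF PQ(1,2) antimono, folded D_def M_def]
      have nth: "fls_nth (corner_det n j M) (\<Sum>l = j..<n. \<alpha> $ l) \<noteq> 0"
        using that coeffs(2) lead by simp
      hence "corner_det n j M \<noteq> 0" by auto
      thus ?thesis
        using fls_subdegree_eqI[OF nth] coeffs(1) by blast
    qed
    have "map_mat fps_to_fls (map_mat fps_const B) = map_mat fls_const B" for B :: "'a mat"
      by (intro eq_matI) auto
    moreover have "D \<in> carrier_mat n n" "map_mat fps_to_fls g\<^sub>1 * (D * map_mat fps_to_fls h\<^sub>1) \<in> carrier_mat n n"
      using carrier by (auto simp: D_def intro!: mult_carrier_mat[of _ n n])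
    ultimately have "M = map_mat fls_const A * x * map_mat fls_const h"
      unfolding M_def P_def Q_def x_eq using carrier A h
      by (simp add: F.mat_hom_mult[of _ n n _ n] assoc_mult_mat[of _ n n _ n _ n])
    moreover have "map_mat \<iota> (map_mat fls_const B) = map_mat puiseux_const B" for B
      by (intro eq_matI) (auto simp: const)
    ultimately have M: "map_mat puiseux_const A * map_mat \<iota> x * map_mat puiseux_const h = map_mat \<iota> M"
      using carrier A h by (simp add: mat_hom_mult[of _ n n _ n])
    have eval: "mpoly_eval puiseux_const (($$) (map_mat \<iota> M)) (corner_minor n j) = \<iota> (corner_det n j M)" for j
      using PQ(3) by (simp add: mpoly_eval_corner_minor[OF puiseux_const_hom, of _ n] hom_corner_det)
    let ?y = "corner_det n i M / corner_det n (Suc i) M"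
    have "ratfun_value puiseux_const n (spherical_fun n i) (map_mat \<iota> M) (\<iota> ?y)"
      unfolding ratfun_value_def spherical_fun_def using corner[OF lead_nz(2)]
      by (intro bexI[of _ "corner_minor n i"] bexI[of _ "corner_minor n (Suc i)"])
         (auto simp: eval divide eq_0_iff corner_minor_mpolys)
    moreover have "?y \<noteq> 0"
      using corner lead_nz by simp
    \<comment> \<open>The tail sums from \<open>i\<close> and from \<open>Suc i\<close> differ by
      \<open>\<alpha> $ i\<close>; for the last index the second sum is empty, matching the empty
      minor.\<close>
    moreover have "fls_subdegree ?y = \<alpha> $ i"
      using corner[OF lead_nz(1)] corner[OF lead_nz(2)] i
      by (simp add: fls_divide_subdegree sum.atLeast_Suc_lessThan)
    ultimately show "\<exists>y. ratfun_value puiseux_const n (spherical_fun n i)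
        (map_mat puiseux_const (the (mat_inverse g)) * map_mat \<iota> x * map_mat puiseux_const h) y \<and>
      y \<noteq> 0 \<and> puiseux_val y = c * of_int (\<alpha> $ i)"
      unfolding A_def[symmetric] M by (intro exI[of _ "\<iota> ?y"]) (simp add: eq_0_iff val)
  qed
qed

lemma spherical_trop_vec:
  fixes x :: "'a::alg_closed_field fls mat" and \<alpha> :: "int vec"
  assumes "fls_rescaling \<iota> c" "x \<in> points_over fls_const n Y" "is_invariant_factors n x \<alpha>"
  shows "vec n (\<lambda>i. trop_val n (map_mat \<iota> x) (spherical_fun n i)) = c \<cdot>\<^sub>v map_vec rat_of_int \<alpha>"
proof (rule eq_vecI)
  have "x \<in> carrier_mat n n"
    using assms(2) by (auto simp: points_over_def dest: GL_carrier)
  moreover have \<alpha>: "\<alpha> \<in> carrier_vec n"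
    using assms(3) by (simp add: is_invariant_factors_def)
  ultimately show "vec n (\<lambda>i. trop_val n (map_mat \<iota> x) (spherical_fun n i)) $ i = (c \<cdot>\<^sub>v map_vec rat_of_int \<alpha>) $ i"
    if "i < dim_vec (c \<cdot>\<^sub>v map_vec rat_of_int \<alpha>)" for i
    using that trop_val_spherical_fun[OF assms(1) _ assms(3)] by auto
  show "dim_vec (vec n (\<lambda>i. trop_val n (map_mat \<iota> x) (spherical_fun n i))) = dim_vec (c \<cdot>\<^sub>v map_vec rat_of_int \<alpha>)"
    using \<alpha> by simp
qed

section \<open>Constant points\<close>

lemma points_over_const:
  assumes "comm_ring_hom \<phi>" "y \<in> Y" "y \<in> GL n"
  shows "map_mat \<phi> y \<in> points_over \<phi> n Y"
proof -
  interpret comm_ring_hom \<phi> by fact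
  have "mpoly_eval \<phi> (($$) (map_mat \<phi> y)) p = 0" if p: "p \<in> vanishing_ideal n Y" for p
  proof -
    have "mpoly_eval \<phi> (($$) (map_mat \<phi> y)) p = mpoly_eval \<phi> (\<lambda>v. \<phi> (y $$ v)) p"
      using p GL_carrier[OF assms(3)]
      by (intro mpoly_eval_cong[of p "mat_vars n"]) (auto simp: vanishing_ideal_def)
    also have "\<dots> = \<phi> (mpoly_eval (\<lambda>c. c) (($$) y) p)"
      by (simp add: hom_mpoly_eval)
    also have "\<dots> = 0"
      using p assms(2) by (simp add: vanishing_ideal_def)
    finally show ?thesis .
  qed
  thus ?thesis
    using hom_GL[OF assms(3)] by (simp add: points_over_def)
qed

text \<open>The constant polynomial 1 vanishes on the empty set but at no point over a nonzero ring.
  Hence a point over \<open>K\<close> forces \<open>Y\<close> to be nonempty.\<close>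

lemma points_over_empty:
  fixes \<phi> :: "'a::field \<Rightarrow> 'r::comm_ring_1"
  assumes "comm_ring_hom \<phi>"
  shows "points_over \<phi> n {} = {}"
proof -
  interpret \<phi>: comm_ring_hom \<phi> by fact
  have "mpoly_eval \<phi> (($$) x) 1 = 1" for x :: "'r mat"
    using \<phi>.mpoly_eval_const[of "($$) x" 1] by simp
  moreover have "(1 :: (nat \<times> nat, 'a) mpoly) \<in> vanishing_ideal n {}"
    by (simp add: vanishing_ideal_def mpolys_1)
  ultimately show ?thesis
    unfolding points_over_def by (smt (verit) empty_Collect_eq zero_neq_one)
qed

text \<open>The inverse of a constant matrix is integral, so it reduces the matrix to the identity
  by left multiplication alone.\<close>

lemma is_invariant_factors_const:
  fixes y :: "'a::field mat"
  assumes "y \<in> GL n"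
  shows "is_invariant_factors n (map_mat fls_const y) (0\<^sub>v n)"
proof -
  interpret comm_ring_hom "fps_const :: 'a \<Rightarrow> _"
    by (rule fps_const_hom)
  interpret c: comm_ring_hom "fls_const :: 'a \<Rightarrow> _"
    by (rule fls_const_hom)
  interpret F: comm_ring_hom "fps_to_fls :: 'a fps \<Rightarrow> 'a fls"
    by (rule fps_to_fls_hom)
  obtain z where z: "z \<in> GL n" "z * y = 1\<^sub>m n"
    using GL_obtain_inverse[OF assms] by metis
  have "map_mat fps_to_fls (map_mat fps_const z) = map_mat fls_const z"
    by (intro eq_matI) auto
  hence "map_mat fps_to_fls (map_mat fps_const z) * map_mat fls_const y * map_mat fps_to_fls (1\<^sub>m n) = 1\<^sub>m n"
    using z GL_carrier[OF assms] GL_carrier[OF z(1)]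
    by (simp add: F.mat_hom_one c.mat_hom_one flip: c.mat_hom_mult[of _ n n _ n])
  moreover have "mat_diag n (\<lambda>i. fls_X_intpow (0\<^sub>v n $ i)) = (1\<^sub>m n :: 'a fls mat)"
    by (intro eq_matI) (auto simp: mat_diag_def)
  ultimately show ?thesis
    unfolding is_invariant_factors_def using hom_GL[OF z(1)] GL_one
    by (metis (no_types, lifting) index_zero_vec(1) le_less_trans order_refl zero_carrier_vec)
qed

theorem theorem1p3:
  fixes Y :: "'k::alg_closed_field mat set" and n :: nat
  assumes "zclosed_GL n Y"
  shows "spherical_trop n Y =
    {c \<cdot>\<^sub>v map_vec rat_of_int \<alpha> | c \<alpha>.
       0 \<le> c \<and> (\<exists>x\<in>points_over fls_const n Y. is_invariant_factors n x \<alpha>)}"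
proof (intro equalityI subsetI)
  fix v assume "v \<in> spherical_trop n Y"
  then obtain \<gamma> where \<gamma>: "\<gamma> \<in> points_over puiseux_const n Y" "v = vec n (\<lambda>i. trop_val n \<gamma> (spherical_fun n i))"
    by (auto simp: spherical_trop_def)
  hence carrier: "\<gamma> \<in> carrier_mat n n"
    by (auto simp: points_over_def dest: GL_carrier)
  \<comment> \<open>Finitely many entries admit a common denominator, so the point is the image of a
    matrix over \<open>k((t))\<close> under a single substitution.\<close>
  obtain m where m: "(\<lambda>ij. \<gamma> $$ ij) ` mat_vars n \<subseteq> range (puiseux_root m)"
    using puiseux_common_root[of "(\<lambda>ij. \<gamma> $$ ij) ` mat_vars n"] by auto
  interpret fls_rescaling "puiseux_root m :: 'k fls \<Rightarrow> _" "1 / of_nat (Suc m)"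
    by (rule fls_rescaling_root)
  have "\<exists>f. puiseux_root m f = \<gamma> $$ (i, j)" if "i < n" "j < n" for i j
  proof -
    have "\<gamma> $$ (i, j) \<in> range (puiseux_root m)"
      using m that by blast
    thus ?thesis by (metis rangeE)
  qed
  then obtain f where f: "\<And>i j. i < n \<Longrightarrow> j < n \<Longrightarrow> puiseux_root m (f i j) = \<gamma> $$ (i, j)"
    by metis
  define x where "x = mat n n (\<lambda>(i, j). f i j)"
  have x: "\<gamma> = map_mat (puiseux_root m) x"
    using carrier by (intro eq_matI) (auto simp: x_def f)
  have x_point: "x \<in> points_over fls_const n Y"
    using \<gamma>(1) by (simp add: x points_over_iff)
  then obtain \<alpha> where "is_invariant_factors n x \<alpha>"
    using invariant_factors_exist[of x n] by (auto simp: points_over_def)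
  thus "v \<in> {c \<cdot>\<^sub>v map_vec rat_of_int \<alpha> | c \<alpha>.
      0 \<le> c \<and> (\<exists>x\<in>points_over fls_const n Y. is_invariant_factors n x \<alpha>)}"
    using spherical_trop_vec[OF fls_rescaling_root x_point] x_point \<gamma>(2)
    by (intro CollectI exI[of _ "1 / of_nat (Suc m)"] exI[of _ \<alpha>]) (auto simp: x)
next
  fix v
  assume "v \<in> {c \<cdot>\<^sub>v map_vec rat_of_int \<alpha> | c \<alpha>.
      0 \<le> c \<and> (\<exists>x\<in>points_over fls_const n Y. is_invariant_factors n x \<alpha>)}"
  then obtain c \<alpha> x where c: "0 \<le> c" and x: "x \<in> points_over fls_const n Y" "is_invariant_factors n x \<alpha>"
    and v: "v = c \<cdot>\<^sub>v map_vec rat_of_int \<alpha>"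
    by blast
  show "v \<in> spherical_trop n Y"
  proof (cases "c = 0")
    case True
    have "Y \<noteq> {}"
      using x(1) points_over_empty[OF fls_const_hom] by auto
    then obtain y where y: "y \<in> Y" "y \<in> GL n"
      using assms by (auto simp: zclosed_GL_def)
    let ?y = "map_mat fls_const y"
    have point: "?y \<in> points_over fls_const n Y"
      using y by (rule points_over_const[OF fls_const_hom])
    interpret fls_rescaling "puiseux_root 0 :: 'k fls \<Rightarrow> _" "1 / of_nat (Suc 0)"
      by (rule fls_rescaling_root)
    have "v = 1 / of_nat (Suc 0) \<cdot>\<^sub>v map_vec rat_of_int (0\<^sub>v n)"
      using x(2) by (intro eq_vecI) (auto simp: v True is_invariant_factors_def)
    also have "\<dots> = vec n (\<lambda>i. trop_val n (map_mat (puiseux_root 0) ?y) (spherical_fun n i))"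
      using spherical_trop_vec[OF fls_rescaling_root point is_invariant_factors_const[OF y(2)]] by simp
    finally show ?thesis
      using point points_over_iff unfolding spherical_trop_def by blast
  next
    case False
    \<comment> \<open>With \<open>c = a / b\<close> in lowest terms,
      \<open>t \<mapsto> t^(a/b)\<close> scales all orders by \<open>c\<close>;
      \<open>nat b - 1\<close> accounts for the shifted index of
      \<open>puiseux_root\<close>.\<close>
    obtain a b where ab: "quotient_of c = (a, b)"
      by fastforce
    hence "b > 0" "c = of_int a / of_int b"
      using quotient_of_denom_pos quotient_of_div by auto
    moreover from this have "a > 0"
      using c False by (auto simp: zero_le_divide_iff)
    ultimately have c: "c = of_nat (nat a) / of_nat (Suc (nat b - 1))" "nat a > 0"
      by auto
    define \<iota> where "\<iota> = (\<lambda>f :: 'k fls. puiseux_root (nat b - 1) (fls_compose_power f (nat a)))"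
    have rescaling: "fls_rescaling \<iota> c"
      unfolding \<iota>_def c(1) by (rule fls_rescaling_root_power[OF c(2)])
    have "v = vec n (\<lambda>i. trop_val n (map_mat \<iota> x) (spherical_fun n i))"
      using spherical_trop_vec[OF rescaling x] v by simp
    moreover have "map_mat \<iota> x \<in> points_over puiseux_const n Y"
      using fls_rescaling.points_over_iff[OF rescaling] x(1) by blast
    ultimately show ?thesis
      unfolding spherical_trop_def by blast
  qed
qed

end
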